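(* Assume that $(\mathcal{H}_T)$, $(\mathcal{H}_\varphi)$, $(\mathcal{H}_K)$ and $(\mathcal{H}_0)$ hold and $m\in V^*$. Then for each $a\in A$, the solution set $\Gamma(a)$ of $\mathrm{MQVI}(a)$ is nonempty, bounded and weakly closed in $V$.
   Context: Let $V$ be a real reflexive Banach space with dual $V^*$ and duality pairing $\langle\cdot,\cdot\rangle$, let $C\subseteq V$ be nonempty, closed and convex, let $B$ be a real Banach space and $A\subseteq B$ a nonempty set of parameters. Given $T\colon B\times V\to V^*$, $\varphi\colon V\to\mathbb{R}\cup\{+\infty\}$, $K\colon C\to 2^C$ and $m\in V^*$, for $a\in A$ the mixed quasi-variational inequality $\mathrm{MQVI}(a)$ is: find $u\in C$ with $u\in K(u)$ and $\langle T(a,u),v-u\rangle+\varphi(v)-\varphi(u)\ge\langle m,v-u\rangle$ for all $v\in K(u)$. $\Gamma(a)$ denotes the set of solutions of $\mathrm{MQVI}(a)$. Hypothesis $(\mathcal{H}_T)$: $T$ is bounded (maps bounded sets to bounded sets); for each $u\in V$ the map $T(\cdot,u)\colon B\to V^*$ is linear; for each $a\in A$ the map $T(a,\cdot)\colon V\to V^*$ is monotone and continuous. Hypothesis $(\mathcal{H}_\varphi)$: $\varphi$ is proper, convex and lower semicontinuous, and $C\subseteq\operatorname{int}(\operatorname{dom}\varphi)$. Hypothesis $(\mathcal{H}_K)$: for every $u\in C$ the set $K(u)\subseteq C$ is nonempty, closed and convex, and (i) for any sequence $\{x_n\}\subset C$ with $x_n\rightharpoonup x$ weakly and any $y\in K(x)$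 there is a sequence $\{y_n\}\subset C$ with $y_n\in K(x_n)$ and $y_n\to y$ strongly; (ii) for any sequences $\{x_n\},\{y_n\}\subset C$ with $y_n\in K(x_n)$, $x_n\rightharpoonup x$ and $y_n\rightharpoonup y$, one has $y\in K(x)$. Hypothesis $(\mathcal{H}_0)$: there is a bounded set $C_0\subseteq V$ with $K(u)\cap C_0\neq\emptyset$ for every $u\in C$, and a function $h\colon[0,\infty)\to\mathbb{R}$ with $h(t)\to+\infty$ as $t\to+\infty$ such that $\langle T(a,w),w-v_0\rangle+\varphi(w)-\varphi(v_0)\ge h(\|w\|_V)\|w\|_V$ for all $v_0\in C_0$, $a\in A$, $w\in C$. *)

theory Defs
  imports "HOL-Analysis.Analysis"
begin

text \<open>The dual space V* is represented by the bounded linear functionals 'v \<Rightarrow>L real,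
  the duality pairing by function application.\<close>

definition reflexive_space :: "'v::banach itself \<Rightarrow> bool" where
  "reflexive_space _ \<longleftrightarrow>
     (\<forall>\<Phi> :: ('v \<Rightarrow>\<^sub>L real) \<Rightarrow>\<^sub>L real. \<exists>x::'v. \<forall>f. blinfun_apply \<Phi> f = blinfun_apply f x)"

definition weak_conv :: "(nat \<Rightarrow> 'v::real_normed_vector) \<Rightarrow> 'v \<Rightarrow> bool" where
  "weak_conv xs x \<longleftrightarrow> (\<forall>f :: 'v \<Rightarrow>\<^sub>L real. (\<lambda>n. blinfun_apply f (xs n)) \<longlonglongrightarrow> blinfun_apply f x)"

definition weakly_open :: "'v::real_normed_vector set \<Rightarrow> bool" where
  "weakly_open S \<longleftrightarrow> (\<forall>x\<in>S. \<exists>F :: ('v \<Rightarrow>\<^sub>L real) set. finite F \<and> (\<exists>e>0.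
       {y. \<forall>f\<in>F. \<bar>blinfun_apply f y - blinfun_apply f x\<bar> < e} \<subseteq> S))"

definition weakly_closed :: "'v::real_normed_vector set \<Rightarrow> bool" where
  "weakly_closed S \<longleftrightarrow> weakly_open (- S)"

definition monotone_op :: "('v::real_normed_vector \<Rightarrow> ('v \<Rightarrow>\<^sub>L real)) \<Rightarrow> bool" where
  "monotone_op S \<longleftrightarrow> (\<forall>u v. blinfun_apply (S u - S v) (u - v) \<ge> 0)"

definition dom_fun :: "('v \<Rightarrow> ereal) \<Rightarrow> 'v set" where
  "dom_fun \<phi> = {x. \<phi> x < \<infinity>}"

definition proper_fun :: "('v \<Rightarrow> ereal) \<Rightarrow> bool" where
  "proper_fun \<phi> \<longleftrightarrow> (\<forall>x. \<phi> x \<noteq> -\<infinity>) \<and> (\<exists>x. \<phi> x < \<infinity>)"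

definition convex_fun :: "('v::real_vector \<Rightarrow> ereal) \<Rightarrow> bool" where
  "convex_fun \<phi> \<longleftrightarrow> (\<forall>x y t. 0 \<le> t \<and> t \<le> 1 \<longrightarrow>
      \<phi> ((1 - t) *\<^sub>R x + t *\<^sub>R y) \<le> ereal (1 - t) * \<phi> x + ereal t * \<phi> y)"

definition lsc_fun :: "('v::topological_space \<Rightarrow> ereal) \<Rightarrow> bool" where
  "lsc_fun \<phi> \<longleftrightarrow> (\<forall>c::real. closed {x. \<phi> x \<le> ereal c})"

definition Gamma ::
  "('b \<Rightarrow> 'v::real_normed_vector \<Rightarrow> ('v \<Rightarrow>\<^sub>L real)) \<Rightarrow> ('v \<Rightarrow> ereal) \<Rightarrow> ('v \<Rightarrow> 'v set)
     \<Rightarrow> ('v \<Rightarrow>\<^sub>L real) \<Rightarrow> 'v set \<Rightarrow> 'b \<Rightarrow> 'v set" where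
  "Gamma T \<phi> K m C a = {u \<in> C. u \<in> K u \<and>
      (\<forall>v \<in> K u. ereal (blinfun_apply (T a u) (v - u)) + \<phi> v - \<phi> u \<ge> ereal (blinfun_apply m (v - u)))}"

end

theory Submission
  imports Defs
begin

text \<open>Set \<open>S = T a - m\<close>. Coercivity bounds all solutions by some \<open>R\<close>, so one looks for a solution in
  \<open>W = C \<inter> cball 0 (R + 1)\<close>, and by Minty's lemma it suffices to find \<open>u \<in> W\<close> with \<open>u \<in> K u\<close> and
  \<open>minty_gap u y \<ge> 0\<close> for all \<open>y \<in> K u\<close> of norm less than \<open>R + 1\<close>. If there were none, every point of
  \<open>W\<close> would lie in the relatively weakly open set where some \<open>y \<in> K u\<close> has a negative Minty gap, or in one
  of the relatively weakly open sets where a functional \<open>f\<close> separates \<open>u\<close> strictly from \<open>K u \<inter> W\<close>. By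
  weak compactness finitely many of these cover \<open>W\<close>. Weighting Minty gaps and functionals with
  bump functions subordinate to this cover gives a bifunction to which Ky Fan's inequality applies, and the
  point which it yields contradicts the choice of the cover.

  Weak closedness only has to be checked along sequences: in a reflexive space, a point of the weak closure
  of a bounded set is the weak limit of a sequence in it.\<close>

subsection \<open>The Hahn--Banach theorem\<close>

text \<open>The obstacle is that the test points move with \<open>u\<close>, whereas Ky Fan's
  inequality compares all points of one fixed convex set. The two kinds of failure, a negative Minty
  gap and \<open>u\<close> lying off its constraint set, are therefore merged into a single
  bifunction on \<open>W\<close>. The separating functionals do no harm to Ky Fan's condition, since
  linear terms average to zero at a barycentre. Minty gaps are chosen because they behave well under
  weak limits, where norm continuity of \<open>S\<close> says nothing about \<open>S u\<close>.
  Monotonicity pays for the exchange, and Minty's lemma reverses it. Condition (i) on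
  \<open>K\<close> makes nonnegativity of the Minty gaps a weakly closed condition; condition (ii)
  does so for the failure of separation. Both speak of sequences while the cover consists of weakly
  open sets, which is why a sequential description of weak closures has to come first.\<close>

definition sublinear :: "('v::real_vector \<Rightarrow> real) \<Rightarrow> bool" where
  "sublinear p \<longleftrightarrow> (\<forall>x y. p (x + y) \<le> p x + p y) \<and> (\<forall>c x. c > 0 \<longrightarrow> p (c *\<^sub>R x) = c * p x)"

lemma sublinear_add: "sublinear p \<Longrightarrow> p (x + y) \<le> p x + p y"
  and sublinear_scale: "sublinear p \<Longrightarrow> c > 0 \<Longrightarrow> p (c *\<^sub>R x) = c * p x"
  by (auto simp: sublinear_def)

lemma sublinear_0: assumes "sublinear p" shows "p 0 = 0"
  using sublinear_scale[OF assms, of 2 0] by simp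

lemma sublinear_minus: assumes "sublinear p" shows "- p (- x) \<le> p x"
  using sublinear_add[OF assms, of x "-x"] sublinear_0[OF assms] by simp

text \<open>For subadditivity, the smaller one \<open>s\<close> of two members \<open>q\<close> and
  \<open>r\<close> of the chain satisfies \<open>s (x + y) \<le> q x + r y\<close>. This supplies
  the lower bounds that Zorn's lemma asks for.\<close>

lemma sublinear_chain_INF:
  assumes C: "C \<noteq> {}" "\<And>q. q \<in> C \<Longrightarrow> sublinear q"
    and chain: "\<And>q r. q \<in> C \<Longrightarrow> r \<in> C \<Longrightarrow> q \<le> r \<or> r \<le> q"
    and lower: "\<And>x. bdd_below ((\<lambda>q. q x) ` C)"
  shows "sublinear (\<lambda>x. INF q\<in>C. q x)"
  unfolding sublinear_def
proof (intro conjI allI impI)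
  let ?u = "\<lambda>x. INF q\<in>C. q x"
  have u_le: "?u x \<le> q x" if "q \<in> C" for q x
    using lower that by (rule cINF_lower)
  show "?u (x + y) \<le> ?u x + ?u y" for x y
  proof -
    have *: "?u (x + y) \<le> q x + r y" if "q \<in> C" "r \<in> C" for q r
    proof -
      obtain s where s: "s \<in> C" "s \<le> q" "s \<le> r" using chain[OF \<open>q \<in> C\<close> \<open>r \<in> C\<close>] \<open>q \<in> C\<close> \<open>r \<in> C\<close> by blast
      have "?u (x + y) \<le> s (x + y)" by (rule u_le[OF s(1)])
      also have "\<dots> \<le> s x + s y" by (rule sublinear_add[OF C(2)[OF s(1)]])
      also have "\<dots> \<le> q x + r y" using s by (simp add: le_fun_def add_mono)
      finally show ?thesis .
    qed
    have "?u (x + y) - ?u y \<le> q x" if "q \<in> C" for q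
    proof -
      have "?u (x + y) - q x \<le> ?u y"
      proof (rule cINF_greatest[OF C(1)])
        show "?u (x + y) - q x \<le> r y" if "r \<in> C" for r
          using *[OF \<open>q \<in> C\<close> that] by simp
      qed
      then show ?thesis by simp
    qed
    then have "?u (x + y) - ?u y \<le> ?u x" by (intro cINF_greatest C)
    then show ?thesis by simp
  qed
  show "?u (c *\<^sub>R x) = c * ?u x" if "c > 0" for c x
  proof (rule antisym)
    have "?u (c *\<^sub>R x) / c \<le> ?u x"
    proof (rule cINF_greatest[OF C(1)])
      fix q assume "q \<in> C"
      then have "?u (c *\<^sub>R x) \<le> c * q x"
        using u_le[of q "c *\<^sub>R x"] sublinear_scale[OF C(2) that, of q x] by simp
      then show "?u (c *\<^sub>R x) / c \<le> q x" using that by (simp add: field_simps)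
    qed
    then show "?u (c *\<^sub>R x) \<le> c * ?u x" using that by (simp add: field_simps)
    show "c * ?u x \<le> ?u (c *\<^sub>R x)"
    proof (rule cINF_greatest[OF C(1)])
      fix q assume "q \<in> C"
      then show "c * ?u x \<le> q (c *\<^sub>R x)"
        using u_le[of q x] sublinear_scale[OF C(2) that, of q x] that by simp
    qed
  qed
qed

text \<open>A minimal \<open>p\<close> must coincide with \<open>q\<close>, and the last property of
  \<open>q\<close> then reads \<open>p (- y) \<le> - p y\<close>, the half of oddness that
  sublinearity alone does not give.\<close>

lemma sublinear_shift:
  assumes p: "sublinear p"
  obtains q where "sublinear q" "q \<le> p" "q (- y) \<le> - p y"
proof
  \<comment> \<open>The infimal convolution of \<open>p\<close> with the function taking the value
    \<open>- t * p y\<close> at \<open>t *\<^sub>R (- y)\<close>; \<open>t = 0\<close> gives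
    \<open>q \<le> p\<close>, and \<open>t = 1\<close> gives the value at
    \<open>- y\<close>.\<close>
  define q where "q x = (INF t\<in>{0..}. p (x + t *\<^sub>R y) - t * p y)" for x
  have lb: "- p (- x) \<le> p (x + t *\<^sub>R y) - t * p y" if "t \<ge> 0" for x t
  proof -
    have "t * p y = p (t *\<^sub>R y)"
      using that sublinear_scale[OF p, of t y] sublinear_0[OF p] by (cases "t = 0") auto
    also have "\<dots> \<le> p (x + t *\<^sub>R y) + p (- x)"
      using sublinear_add[OF p, of "x + t *\<^sub>R y" "- x"] by simp
    finally show ?thesis by simp
  qed
  then have bdd: "bdd_below ((\<lambda>t. p (x + t *\<^sub>R y) - t * p y) ` {0..})" for x
    by (intro bdd_belowI2[where m = "- p (- x)"]) auto
  have q_le: "q x \<le> p (x + t *\<^sub>R y) - t * p y" if "t \<ge> 0" for x t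
    unfolding q_def using bdd that by (intro cINF_lower) auto
  show "q \<le> p" using q_le[of 0] by (simp add: le_fun_def)
  show "q (- y) \<le> - p y" using q_le[of 1 "- y"] sublinear_0[OF p] by simp
  show "sublinear q"
    unfolding sublinear_def
  proof (intro conjI allI impI)
    show "q (x + z) \<le> q x + q z" for x z
    proof -
      have *: "q (x + z) \<le> (p (x + s *\<^sub>R y) - s * p y) + (p (z + t *\<^sub>R y) - t * p y)"
        if "s \<ge> 0" "t \<ge> 0" for s t
        using q_le[of "s + t" "x + z"] sublinear_add[OF p, of "x + s *\<^sub>R y" "z + t *\<^sub>R y"] that
        by (simp add: algebra_simps)
      have "q (x + z) - (p (x + s *\<^sub>R y) - s * p y) \<le> q z" if "s \<ge> 0" for s
        unfolding q_def[of z] by (rule cINF_greatest) (use *[OF that] in \<open>auto simp: algebra_simps\<close>)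
      then have "q (x + z) - q z \<le> p (x + s *\<^sub>R y) - s * p y" if "s \<ge> 0" for s
        using that by (simp add: algebra_simps)
      then have "q (x + z) - q z \<le> q x" unfolding q_def[of x] by (intro cINF_greatest) auto
      then show ?thesis by simp
    qed
    have half: "q (c *\<^sub>R x) \<le> c * q x" if "c > 0" for c x
    proof -
      have "q (c *\<^sub>R x) / c \<le> q x"
        unfolding q_def[of x]
      proof (rule cINF_greatest)
        fix t :: real assume "t \<in> {0..}"
        then have "q (c *\<^sub>R x) \<le> p (c *\<^sub>R x + (c * t) *\<^sub>R y) - (c * t) * p y"
          using that by (intro q_le) simp
        also have "p (c *\<^sub>R x + (c * t) *\<^sub>R y) = c * p (x + t *\<^sub>R y)"
          using sublinear_scale[OF p that, of "x + t *\<^sub>R y"] by (simp add: algebra_simps)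
        finally show "q (c *\<^sub>R x) / c \<le> p (x + t *\<^sub>R y) - t * p y"
          using that by (simp add: field_simps)
      qed simp
      then show ?thesis using that by (simp add: field_simps)
    qed
    show "q (c *\<^sub>R x) = c * q x" if "c > 0" for c x
      using half[OF that, of x] half[of "1 / c" "c *\<^sub>R x"] that by (simp add: field_simps)
  qed
qed

text \<open>By Zorn's lemma there is a minimal sublinear functional below \<open>p\<close>; minimality against the
  shifts of the previous lemma makes it odd, hence linear.\<close>

theorem sublinear_dominates_linear:
  fixes p :: "'v::real_vector \<Rightarrow> real"
  assumes p: "sublinear p"
  obtains f where "linear f" "\<And>x. f x \<le> p x"
proof -
  define A where "A = {q. sublinear q \<and> q \<le> p}"
  have "\<exists>f\<in>A. \<forall>q\<in>A. q \<le> f \<longrightarrow> q = f"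
  proof (rule predicate_Zorn)
    \<comment> \<open>The order is reversed, so that maximality means minimality among the sublinear
      functionals below \<open>p\<close>.\<close>
    show "partial_order_on A (relation_of (\<lambda>q r. r \<le> q) A)"
      by (rule partial_order_on_relation_ofI) auto
    fix C assume C: "C \<in> Chains (relation_of (\<lambda>q r. r \<le> q) A)"
    then have CA: "C \<subseteq> A" and tot: "\<And>q r. q \<in> C \<Longrightarrow> r \<in> C \<Longrightarrow> q \<le> r \<or> r \<le> q"
      by (auto simp: Chains_def relation_of_def)
    show "\<exists>u\<in>A. \<forall>q\<in>C. u \<le> q"
    proof (cases "C = {}")
      case True
      then show ?thesis using p by (auto simp: A_def)
    next
      case False
      have "- p (- x) \<le> q x" if "q \<in> C" for q x
      proof -
        have "sublinear q" "q (- x) \<le> p (- x)" using that CA by (auto simp: A_def le_fun_def)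
        then show ?thesis using sublinear_minus[of q x] by linarith
      qed
      then have bdd: "bdd_below ((\<lambda>q. q x) ` C)" for x
        by (intro bdd_belowI2[where m = "- p (- x)"]) auto
      define u where "u x = (INF q\<in>C. q x)" for x
      have u_le: "u \<le> q" if "q \<in> C" for q
        unfolding le_fun_def u_def using that bdd by (auto intro: cINF_lower)
      have "sublinear u"
        unfolding u_def by (rule sublinear_chain_INF) (use False CA tot bdd in \<open>auto simp: A_def\<close>)
      moreover have "u \<le> p" using u_le False CA unfolding A_def by fastforce
      ultimately show ?thesis using u_le by (auto simp: A_def)
    qed
  qed
  then obtain f where f: "sublinear f" "f \<le> p" and min: "\<And>q. sublinear q \<Longrightarrow> q \<le> f \<Longrightarrow> q = f"
    by (auto simp: A_def)
  have odd: "f (- y) = - f y" for y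
  proof -
    obtain q where "sublinear q" "q \<le> f" "q (- y) \<le> - f y" by (rule sublinear_shift[OF f(1)])
    then have "f (- y) \<le> - f y" using min by auto
    then show ?thesis using sublinear_minus[OF f(1), of y] by simp
  qed
  have "linear f"
  proof (rule linearI)
    show "f (x + y) = f x + f y" for x y
      using sublinear_add[OF f(1), of x y] sublinear_add[OF f(1), of "- x" "- y"] odd[of "x + y"]
      by (simp add: odd)
    show "f (c *\<^sub>R x) = c *\<^sub>R f x" for c x
    proof -
      consider "c > 0" | "c = 0" | "c < 0" by linarith
      then show ?thesis
      proof cases
        case 3
        then have "f ((- c) *\<^sub>R x) = - c * f x" by (intro sublinear_scale f) simp
        then show ?thesis by (simp add: odd)
      qed (use sublinear_scale[OF f(1)] sublinear_0[OF f(1)] in auto)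
    qed
  qed
  then show ?thesis using that f(2) by (auto simp: le_fun_def)
qed

text \<open>Near-minimisers are combined, as the distance may fail to be attained. This convexity
  makes the directional derivative of the distance subadditive in
  \<open>separation_infdist\<close>.\<close>

lemma infdist_convex_combination:
  fixes S :: "'v::real_normed_vector set"
  assumes S: "convex S" "S \<noteq> {}" and a: "a \<ge> 0" "b \<ge> 0" "a + b = 1"
  shows "infdist (a *\<^sub>R x + b *\<^sub>R y) S \<le> a * infdist x S + b * infdist y S"
proof (rule field_le_epsilon)
  fix e :: real assume "e > 0"
  obtain s where s: "s \<in> S" "dist x s < infdist x S + e"
    using cInf_lessD[of "dist x ` S" "infdist x S + e"] S(2) \<open>e > 0\<close>
    by (auto simp: infdist_notempty)
  obtain t where t: "t \<in> S" "dist y t < infdist y S + e"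
    using cInf_lessD[of "dist y ` S" "infdist y S + e"] S(2) \<open>e > 0\<close>
    by (auto simp: infdist_notempty)
  have "a *\<^sub>R s + b *\<^sub>R t \<in> S" using S a s t by (simp add: convexD)
  then have "infdist (a *\<^sub>R x + b *\<^sub>R y) S \<le> dist (a *\<^sub>R x + b *\<^sub>R y) (a *\<^sub>R s + b *\<^sub>R t)"
    by (rule infdist_le)
  also have "\<dots> = norm (a *\<^sub>R (x - s) + b *\<^sub>R (y - t))" by (simp add: dist_norm algebra_simps)
  also have "\<dots> \<le> a * dist x s + b * dist y t"
    using norm_triangle_ineq[of "a *\<^sub>R (x - s)" "b *\<^sub>R (y - t)"] a by (simp add: dist_norm)
  also have "\<dots> \<le> a * (infdist x S + e) + b * (infdist y S + e)"
    using s t a by (intro add_mono mult_left_mono) auto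
  also have "\<dots> = a * infdist x S + b * infdist y S + (a + b) * e" by (simp add: algebra_simps)
  finally show "infdist (a *\<^sub>R x + b *\<^sub>R y) S \<le> a * infdist x S + b * infdist y S + e"
    using a by simp
qed

text \<open>The functional is obtained below the directional derivative at \<open>x\<close> of the distance to \<open>S\<close>.\<close>

theorem separation_infdist:
  fixes S :: "'v::real_normed_vector set"
  assumes S: "convex S" "S \<noteq> {}"
  obtains f :: "'v \<Rightarrow>\<^sub>L real"
  where "\<And>z. \<bar>blinfun_apply f z\<bar> \<le> norm z"
    and "\<And>s. s \<in> S \<Longrightarrow> blinfun_apply f x - blinfun_apply f s \<ge> infdist x S"
proof -
  define d where "d y = infdist y S" for y
  define r where "r t h = (d (x + t *\<^sub>R h) - d x) / t" for t h
  define p where "p h = (INF t\<in>{0<..}. r t h)" for h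
  have lip: "\<bar>d y - d z\<bar> \<le> norm (y - z)" for y z
    unfolding d_def using infdist_triangle_abs[of y S z] by (simp add: dist_norm)
  have r_bound: "\<bar>r t h\<bar> \<le> norm h" if "t > 0" for t h
    using lip[of "x + t *\<^sub>R h" x] that by (simp add: r_def abs_divide pos_divide_le_eq mult.commute)
  have bdd: "bdd_below ((\<lambda>t. r t h) ` {0<..})" for h
    by (rule bdd_belowI2[where m = "- norm h"]) (use r_bound[of _ h] in \<open>force simp: abs_le_iff minus_le_iff\<close>)
  have p_le: "p h \<le> r t h" if "t > 0" for t h
    unfolding p_def using bdd that by (intro cINF_lower) auto
  have "sublinear p"
    unfolding sublinear_def
  proof (intro conjI allI impI)
    show "p (h + k) \<le> p h + p k" for h k
    proof -
      have *: "p (h + k) \<le> r s h + r t k" if st: "s > 0" "t > 0" for s t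
      proof -
        \<comment> \<open>With this \<open>c\<close>, \<open>x + c *\<^sub>R (h + k)\<close> is a
          convex combination of \<open>x + s *\<^sub>R h\<close> and
          \<open>x + t *\<^sub>R k\<close>, and the quotients add up because
          \<open>1 / c = 1 / s + 1 / t\<close>.\<close>
        define c where "c = s * t / (s + t)"
        have c: "c > 0" using st by (simp add: c_def)
        have inv: "t / (s + t) / c = 1 / s" "s / (s + t) / c = 1 / t" "1 / c = 1 / s + 1 / t"
          using st by (simp_all add: c_def add_divide_distrib)
        have ab: "t / (s + t) + s / (s + t) = 1" using st by (simp flip: add_divide_distrib)
        have "d (x + c *\<^sub>R (h + k))
            = d ((t / (s + t)) *\<^sub>R (x + s *\<^sub>R h) + (s / (s + t)) *\<^sub>R (x + t *\<^sub>R k))"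
        proof -
          have "(t / (s + t)) *\<^sub>R (x + s *\<^sub>R h) + (s / (s + t)) *\<^sub>R (x + t *\<^sub>R k)
              = (t / (s + t) + s / (s + t)) *\<^sub>R x + c *\<^sub>R (h + k)"
            by (simp add: c_def algebra_simps)
          then show ?thesis by (simp add: ab)
        qed
        also have "\<dots> \<le> (t / (s + t)) * d (x + s *\<^sub>R h) + (s / (s + t)) * d (x + t *\<^sub>R k)"
          unfolding d_def using st ab by (intro infdist_convex_combination S) auto
        finally have "r c (h + k) \<le> ((t / (s + t)) * d (x + s *\<^sub>R h)
            + (s / (s + t)) * d (x + t *\<^sub>R k) - d x) / c"
          unfolding r_def using c by (simp add: divide_right_mono)
        also have "\<dots> = d (x + s *\<^sub>R h) * (t / (s + t) / c) + d (x + t *\<^sub>R k) * (s / (s + t) / c)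
            - d x * (1 / c)"
          by (simp add: diff_divide_distrib add_divide_distrib mult.commute)
        also have "\<dots> = r s h + r t k"
          unfolding r_def inv by (simp add: diff_divide_distrib distrib_left)
        finally show ?thesis using p_le[OF c, of "h + k"] by linarith
      qed
      have "p (h + k) - r s h \<le> p k" if "s > 0" for s
        unfolding p_def[of k] by (rule cINF_greatest) (use *[OF that] in \<open>auto simp: algebra_simps\<close>)
      then have "p (h + k) - p k \<le> r s h" if "s > 0" for s
        using that by (simp add: algebra_simps)
      then have "p (h + k) - p k \<le> p h" unfolding p_def[of h] by (intro cINF_greatest) auto
      then show ?thesis by simp
    qed
    have half: "p (c *\<^sub>R h) \<le> c * p h" if "c > 0" for c h
    proof -
      have "p (c *\<^sub>R h) / c \<le> p h"
        unfolding p_def[of h]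
      proof (rule cINF_greatest)
        fix t :: real assume "t \<in> {0<..}"
        then have "p (c *\<^sub>R h) \<le> r (t / c) (c *\<^sub>R h)" using that by (intro p_le) simp
        also have "\<dots> = c * r t h" using that by (simp add: r_def)
        finally show "p (c *\<^sub>R h) / c \<le> r t h" using that by (simp add: field_simps)
      qed simp
      then show ?thesis using that by (simp add: field_simps)
    qed
    show "p (c *\<^sub>R h) = c * p h" if "c > 0" for c h
      using half[OF that, of h] half[of "1 / c" "c *\<^sub>R h"] that by (simp add: field_simps)
  qed
  then obtain g where g: "linear g" "\<And>h. g h \<le> p h" by (rule sublinear_dominates_linear) blast
  have le: "g h \<le> norm h" for h
    using g(2)[of h] p_le[of 1 h] r_bound[of 1 h] by auto
  have abs: "\<bar>g h\<bar> \<le> norm h" for h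
    using le[of h] le[of "- h"] by (simp add: linear_neg[OF g(1)])
  have bl: "bounded_linear g"
    using g(1) abs by (intro bounded_linear_intro[where K = 1]) (auto simp: linear_add linear_scale)
  show ?thesis
  proof (rule that[of "Blinfun g"])
    show "\<bar>blinfun_apply (Blinfun g) z\<bar> \<le> norm z" for z
      by (simp add: bounded_linear_Blinfun_apply[OF bl] abs)
    fix s assume "s \<in> S"
    \<comment> \<open>For the step \<open>t = 1\<close> in direction \<open>s - x\<close> the
      quotient is \<open>d s - d x\<close>, where \<open>d s = 0\<close>.\<close>
    have "g (s - x) \<le> r 1 (s - x)" using g(2)[of "s - x"] p_le[of 1 "s - x"] by linarith
    also have "\<dots> = - infdist x S" using \<open>s \<in> S\<close> by (simp add: r_def d_def)
    finally show "blinfun_apply (Blinfun g) x - blinfun_apply (Blinfun g) s \<ge> infdist x S"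
      by (simp add: bounded_linear_Blinfun_apply[OF bl] linear_diff[OF g(1)])
  qed
qed

text \<open>The distance of \<open>x\<close> from \<open>{0}\<close> is \<open>norm x\<close>, so
  separation from this singleton forces the value \<open>norm x\<close> on a functional of norm at
  most 1.\<close>

corollary norming_functional:
  fixes x :: "'v::real_normed_vector"
  obtains f :: "'v \<Rightarrow>\<^sub>L real"
  where "\<And>z. \<bar>blinfun_apply f z\<bar> \<le> norm z" "blinfun_apply f x = norm x"
proof -
  obtain f :: "'v \<Rightarrow>\<^sub>L real" where f: "\<And>z. \<bar>blinfun_apply f z\<bar> \<le> norm z"
      "\<And>s. s \<in> {0} \<Longrightarrow> blinfun_apply f x - blinfun_apply f s \<ge> infdist x {0}"
    by (rule separation_infdist[of "{0}" x]) auto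
  have "blinfun_apply f x = norm x"
    using f(1)[of x] f(2)[of 0] by (simp add: blinfun.zero_right)
  then show ?thesis using f(1) that by blast
qed

subsection \<open>Weak compactness and weakly convergent sequences\<close>

text \<open>Tychonoff's theorem for the function type, whose topology is the product topology. It
  serves both the weak compactness of balls and the compactness of the unit cube.\<close>

lemma compact_Pi_UNIV:
  fixes S :: "'i \<Rightarrow> 'a::topological_space set"
  assumes "\<And>i. compact (S i)"
  shows "compact (Pi UNIV S)"
proof -
  have "compactin (product_topology (\<lambda>i. euclidean) UNIV) (Pi\<^sub>E UNIV S)"
    using assms by (simp add: compactin_PiE)
  then show ?thesis by (simp add: euclidean_product_topology PiE_UNIV_domain)
qed

lemma norm_blinfun_le_1:
  fixes f :: "'v::real_normed_vector \<Rightarrow>\<^sub>L real"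
  assumes "\<And>z. \<bar>blinfun_apply f z\<bar> \<le> norm z"
  shows "norm f \<le> 1"
  using assms by (intro norm_blinfun_bound) auto

text \<open>The Banach--Alaoglu argument in the bidual: the evaluations at points of the ball are
  exactly the linear members of a product of compact intervals, and linearity is a closed condition.
  Reflexivity represents such a functional by a point \<open>x\<close>, and a norming functional
  bounds \<open>norm x\<close>.\<close>

lemma compact_evaluation_cball:
  assumes refl: "reflexive_space TYPE('v::banach)"
  shows "compact ((\<lambda>(x::'v) f. blinfun_apply f x :: real) ` cball 0 R)"
proof (cases "R \<ge> 0")
  case R: True
  define P where "P = Pi UNIV (\<lambda>f :: 'v \<Rightarrow>\<^sub>L real. {- R * norm f .. R * norm f})"
  define L where "L = {\<Phi> :: ('v \<Rightarrow>\<^sub>L real) \<Rightarrow> real. linear \<Phi>}"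
  have "L = (\<Inter>f g. {\<Phi>. \<Phi> (f + g) = \<Phi> f + \<Phi> g}) \<inter> (\<Inter>c f. {\<Phi>. \<Phi> (c *\<^sub>R f) = c * \<Phi> f})"
    unfolding L_def by (auto intro!: linearI simp: linear_add linear_scale)
  then have "closed L"
    by (auto intro!: closed_INT closed_Int closed_Collect_eq continuous_intros)
  moreover have "compact P" unfolding P_def by (intro compact_Pi_UNIV) simp
  ultimately have "compact (P \<inter> L)" by (rule compact_Int_closed[rotated])
  moreover have "(\<lambda>(x::'v) f. blinfun_apply f x :: real) ` cball 0 R = P \<inter> L"
  proof (intro equalityI subsetI)
    fix \<Phi> assume "\<Phi> \<in> (\<lambda>(x::'v) f. blinfun_apply f x :: real) ` cball 0 R"
    then obtain x :: 'v where x: "norm x \<le> R" "\<Phi> = (\<lambda>f. blinfun_apply f x)" by auto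
    have "\<bar>\<Phi> f\<bar> \<le> R * norm f" for f
      using norm_blinfun[of f x] mult_left_mono[OF x(1), of "norm f"] x(2) by (simp add: mult.commute)
    then show "\<Phi> \<in> P \<inter> L"
      by (auto simp: P_def L_def x(2) abs_le_iff minus_le_iff blinfun.add_left blinfun.scaleR_left
          intro!: linearI)
  next
    fix \<Phi> assume "\<Phi> \<in> P \<inter> L"
    then have lin: "linear \<Phi>" and b: "\<bar>\<Phi> f\<bar> \<le> R * norm f" for f
      by (auto simp: P_def L_def abs_le_iff minus_le_iff Pi_def)
    have bl: "bounded_linear \<Phi>"
      using lin b by (intro bounded_linear_intro[where K = R])
        (auto simp: linear_add linear_scale mult.commute)
    obtain x where x: "\<And>f. blinfun_apply (Blinfun \<Phi>) f = blinfun_apply f x"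
      using refl unfolding reflexive_space_def by blast
    then have \<Phi>: "\<Phi> f = blinfun_apply f x" for f by (simp add: bounded_linear_Blinfun_apply[OF bl])
    obtain f where f: "\<And>z. \<bar>blinfun_apply f z\<bar> \<le> norm z" "blinfun_apply f x = norm x"
      using norming_functional by blast
    have "norm x \<le> R * norm f" using b[of f] f \<Phi> by simp
    also have "\<dots> \<le> R * 1" by (intro mult_left_mono norm_blinfun_le_1 f R)
    finally show "\<Phi> \<in> (\<lambda>(x::'v) f. blinfun_apply f x :: real) ` cball 0 R"
      using \<Phi> by (intro image_eqI[of _ _ x]) auto
  qed
  ultimately show ?thesis by simp
qed auto

text \<open>The sets \<open>U y\<close> are open for pointwise convergence, and their preimages
  under evaluation are the prescribed weak neighbourhoods. These are given by their data
  \<open>F y\<close> and \<open>e y\<close>, since the type itself carries the norm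
  topology.\<close>

lemma weak_compactness:
  assumes refl: "reflexive_space TYPE('v::banach)"
    and N: "\<And>y::'v. norm y \<le> R \<Longrightarrow> finite (F y) \<and> e y > (0::real)"
  obtains Y where "finite Y" "Y \<subseteq> cball 0 R"
    "\<And>z. norm z \<le> R \<Longrightarrow> \<exists>y\<in>Y. \<forall>f\<in>F y. \<bar>blinfun_apply f z - blinfun_apply f y\<bar> < e y"
proof -
  define ev where "ev = (\<lambda>(x::'v) f. blinfun_apply f x :: real)"
  define U where "U y = (\<Inter>f\<in>F y. {\<Phi>. \<bar>\<Phi> f - blinfun_apply f y\<bar> < e y})" for y
  have op: "open (U y)" if "y \<in> cball 0 R" for y
    unfolding U_def using N that
    by (intro open_INT ballI open_Collect_less continuous_intros) auto
  have cpt: "compact (ev ` cball 0 R)" unfolding ev_def by (rule compact_evaluation_cball[OF refl])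
  have cov: "ev ` cball 0 R \<subseteq> (\<Union>y\<in>cball 0 R. U y)"
    using N by (force simp: U_def ev_def)
  obtain Y where Y: "Y \<subseteq> cball 0 R" "finite Y" "ev ` cball 0 R \<subseteq> (\<Union>y\<in>Y. U y)"
    by (rule compactE_image[OF cpt op cov])
  show ?thesis
  proof (rule that[OF Y(2,1)])
    fix z :: 'v assume "norm z \<le> R"
    then have "ev z \<in> ev ` cball 0 R" by auto
    then obtain y where "y \<in> Y" "ev z \<in> U y" using Y(3) by blast
    then show "\<exists>y\<in>Y. \<forall>f\<in>F y. \<bar>blinfun_apply f z - blinfun_apply f y\<bar> < e y"
      by (auto simp: U_def ev_def)
  qed
qed

text \<open>If every \<open>y\<close> had a neighbourhood missing some \<open>S n\<close>, finitely
  many of them would cover the ball, and the set with the largest of their indices, being contained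
  in the others, would be empty.\<close>

lemma weak_cluster_point:
  assumes refl: "reflexive_space TYPE('v::banach)"
    and S: "\<And>n. S n \<noteq> {}" "decseq S" "\<And>n s. s \<in> S n \<Longrightarrow> norm (s::'v) \<le> R"
  obtains y where "\<And>n F e. finite F \<Longrightarrow> e > 0 \<Longrightarrow>
    \<exists>s\<in>S n. \<forall>f\<in>F. \<bar>blinfun_apply f s - blinfun_apply f y\<bar> < (e::real)"
proof -
  have "\<exists>y. \<forall>n F e. finite F \<and> e > 0 \<longrightarrow>
    (\<exists>s\<in>S n. \<forall>f\<in>F. \<bar>blinfun_apply f s - blinfun_apply f y\<bar> < (e::real))"
  proof (rule ccontr)
    assume "\<not> ?thesis"
    then have "\<forall>y. \<exists>n F e. finite F \<and> e > 0 \<and>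
        (\<forall>s\<in>S n. \<not> (\<forall>f\<in>F. \<bar>blinfun_apply f s - blinfun_apply f y\<bar> < (e::real)))"
      by simp
    then obtain n F e where nFe: "\<And>y. finite (F y) \<and> e y > (0::real)"
        "\<And>y s. s \<in> S (n y) \<Longrightarrow> \<not> (\<forall>f\<in>F y. \<bar>blinfun_apply f s - blinfun_apply f y\<bar> < e y)"
      by metis
    obtain Y where Y: "finite Y"
        "\<And>z. norm z \<le> R \<Longrightarrow> \<exists>y\<in>Y. \<forall>f\<in>F y. \<bar>blinfun_apply f z - blinfun_apply f y\<bar> < e y"
      by (rule weak_compactness[OF refl, of R F e]) (use nFe(1) in auto)
    define N where "N = Max (insert 0 (n ` Y))"
    obtain s where s: "s \<in> S N" using S(1) by blast
    then obtain y where y: "y \<in> Y" "\<forall>f\<in>F y. \<bar>blinfun_apply f s - blinfun_apply f y\<bar> < e y"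
      using Y(2) S(3) by blast
    have "n y \<le> N" unfolding N_def using Y(1) y(1) by (intro Max_ge) auto
    then have "s \<in> S (n y)" using s S(2) by (auto simp: decseq_def)
    then show False using nFe(2) y(2) by blast
  qed
  then obtain y where "\<forall>n F e. finite F \<and> e > 0 \<longrightarrow>
    (\<exists>s\<in>S n. \<forall>f\<in>F. \<bar>blinfun_apply f s - blinfun_apply f y\<bar> < (e::real))" by blast
  then show ?thesis using that[of y] by blast
qed

text \<open>Differences and halves already produce all dyadic multiples, and these approximate the
  real ones. In Whitley's construction closing up under just these two operations keeps every stage
  finite.\<close>

lemma subspace_closure_halving:
  fixes D :: "'v::real_normed_vector set"
  assumes D: "D \<noteq> {}" "\<And>u v. u \<in> D \<Longrightarrow> v \<in> D \<Longrightarrow> u - v \<in> D" "\<And>u. u \<in> D \<Longrightarrow> (1/2) *\<^sub>R u \<in> D"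
  shows "subspace (closure D)"
proof -
  have 0: "0 \<in> D" using D(1,2) by force
  have neg: "- u \<in> D" if "u \<in> D" for u using D(2)[OF 0 that] by simp
  have add: "u + v \<in> D" if "u \<in> D" "v \<in> D" for u v using D(2)[OF that(1) neg[OF that(2)]] by simp
  have nat: "real n *\<^sub>R u \<in> D" if "u \<in> D" for n u
    by (induction n) (use 0 add that in \<open>auto simp: scaleR_add_left\<close>)
  have int: "of_int k *\<^sub>R u \<in> D" if "u \<in> D" for k u
  proof (cases "k \<ge> 0")
    case True then show ?thesis using nat[OF that, of "nat k"] by simp
  next
    case False then show ?thesis using neg[OF nat[OF that, of "nat (- k)"]] by simp
  qed
  have pow: "(1 / 2 ^ n) *\<^sub>R u \<in> D" if "u \<in> D" for n u
  proof (induction n)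
    case (Suc n)
    then show ?case using D(3)[OF Suc] by (simp add: mult.commute)
  qed (use that in simp)
  have scale_D: "c *\<^sub>R u \<in> closure D" if "u \<in> D" for c u
  proof (rule closure_sequential[THEN iffD2], intro exI conjI allI)
    show "(of_int \<lfloor>c * 2 ^ n\<rfloor> / 2 ^ n) *\<^sub>R u \<in> D" for n
      using pow[OF int[OF that, of "\<lfloor>c * 2 ^ n\<rfloor>"], of n] by simp
    have "(\<lambda>n. of_int \<lfloor>c * 2 ^ n\<rfloor> / 2 ^ n) \<longlonglongrightarrow> c"
    proof (rule LIM_zero_cancel, rule Lim_null_comparison)
      have "\<bar>of_int \<lfloor>c * 2 ^ n\<rfloor> / 2 ^ n - c\<bar> \<le> (1 / 2) ^ n" for n
      proof -
        have "\<bar>of_int \<lfloor>c * 2 ^ n\<rfloor> - c * 2 ^ n\<bar> \<le> 1" by linarith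
        then have "\<bar>(of_int \<lfloor>c * 2 ^ n\<rfloor> / 2 ^ n - c) * 2 ^ n\<bar> \<le> 1" by (simp add: left_diff_distrib)
        then show ?thesis by (simp add: abs_mult power_one_over field_simps)
      qed
      then show "\<forall>\<^sub>F n in sequentially. norm (of_int \<lfloor>c * 2 ^ n\<rfloor> / 2 ^ n - c) \<le> (1 / 2) ^ n" by simp
      show "(\<lambda>n. (1 / 2) ^ n :: real) \<longlonglongrightarrow> 0" by (rule LIMSEQ_power_zero) simp
    qed
    then show "(\<lambda>n. (of_int \<lfloor>c * 2 ^ n\<rfloor> / 2 ^ n) *\<^sub>R u) \<longlonglongrightarrow> c *\<^sub>R u"
      by (intro tendsto_intros)
  qed
  show ?thesis
  proof (rule subspaceI)
    show "0 \<in> closure D" using 0 closure_subset by blast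
    show "u + v \<in> closure D" if "u \<in> closure D" "v \<in> closure D" for u v
    proof -
      obtain a b where "\<And>n. a n \<in> D" "a \<longlonglongrightarrow> u" "\<And>n. b n \<in> D" "b \<longlonglongrightarrow> v"
        using \<open>u \<in> closure D\<close> \<open>v \<in> closure D\<close> unfolding closure_sequential by blast
      then have "\<forall>n. a n + b n \<in> D" "(\<lambda>n. a n + b n) \<longlonglongrightarrow> u + v"
        using add by (simp, intro tendsto_add)
      then show ?thesis
        unfolding closure_sequential by (intro exI[of _ "\<lambda>n. a n + b n"] conjI)
    qed
    show "c *\<^sub>R u \<in> closure D" if "u \<in> closure D" for c u
    proof -
      obtain a where "\<And>n. a n \<in> D" "a \<longlonglongrightarrow> u"
        using \<open>u \<in> closure D\<close> unfolding closure_sequential by blast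
      then have "\<forall>n. c *\<^sub>R a n \<in> closure D" "(\<lambda>n. c *\<^sub>R a n) \<longlonglongrightarrow> c *\<^sub>R u"
        using scale_D by (simp, intro tendsto_scaleR tendsto_const)
      then have "c *\<^sub>R u \<in> closure (closure D)"
        by (intro closure_sequential[THEN iffD2] exI[of _ "\<lambda>n. c *\<^sub>R a n"] conjI)
      then show ?thesis by simp
    qed
  qed
qed

text \<open>Mazur's theorem for sequences: a functional separating \<open>x\<close> from
  \<open>S\<close> with gap \<open>infdist x S\<close> would keep its values along \<open>xs\<close>
  away from its value at \<open>x\<close>.\<close>

lemma weak_conv_closed_convex:
  fixes S :: "'v::real_normed_vector set"
  assumes S: "closed S" "convex S" and xs: "\<And>n. xs n \<in> S" "weak_conv xs x"
  shows "x \<in> S"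
proof (rule ccontr)
  assume "x \<notin> S"
  have "S \<noteq> {}" using xs(1) by blast
  obtain f :: "'v \<Rightarrow>\<^sub>L real" where f: "\<And>z. \<bar>blinfun_apply f z\<bar> \<le> norm z"
      "\<And>s. s \<in> S \<Longrightarrow> blinfun_apply f x - blinfun_apply f s \<ge> infdist x S"
    using separation_infdist[OF S(2) \<open>S \<noteq> {}\<close>, of x] by blast
  have "(\<lambda>n. blinfun_apply f (xs n)) \<longlonglongrightarrow> blinfun_apply f x"
    using xs(2) by (simp add: weak_conv_def)
  then have "(\<lambda>n. blinfun_apply f x - blinfun_apply f (xs n)) \<longlonglongrightarrow> blinfun_apply f x - blinfun_apply f x"
    by (intro tendsto_diff tendsto_const)
  then have "infdist x S \<le> 0"
    using f(2) xs(1) by (intro LIMSEQ_le_const[where X = "\<lambda>n. blinfun_apply f x - blinfun_apply f (xs n)"]) auto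
  moreover have "infdist x S > 0"
    using S(1) \<open>S \<noteq> {}\<close> \<open>x \<notin> S\<close> by (rule infdist_pos_not_in_closed)
  ultimately show False by simp
qed

text \<open>Whitley's construction: the points \<open>a n\<close> are chosen together with finite sets \<open>Z n\<close> exhausting a
  dense subset of the closed span of \<open>x\<close> and all \<open>a n\<close>; norming functionals of the members of \<open>Z n\<close>
  separate the points of this span, so that \<open>x\<close> is the only weak cluster point of \<open>a\<close>.\<close>

theorem weak_cluster_sequence:
  assumes refl: "reflexive_space TYPE('v::banach)"
    and bound: "\<And>n s. s \<in> S n \<Longrightarrow> norm (s::'v) \<le> R"
    and cluster: "\<And>n F e. finite F \<Longrightarrow> e > 0 \<Longrightarrow>
      \<exists>s\<in>S n. \<forall>f\<in>F. \<bar>blinfun_apply f s - blinfun_apply f x\<bar> < (e::real)"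
  obtains a where "\<And>n. a n \<in> S n" "weak_conv a x"
proof -
  have "\<forall>z::'v. \<exists>f :: 'v \<Rightarrow>\<^sub>L real. (\<forall>w. \<bar>blinfun_apply f w\<bar> \<le> norm w) \<and> blinfun_apply f z = norm z"
    using norming_functional by metis
  then obtain nf :: "'v \<Rightarrow> 'v \<Rightarrow>\<^sub>L real" where nf: "\<And>z w. \<bar>blinfun_apply (nf z) w\<bar> \<le> norm w"
      "\<And>z. blinfun_apply (nf z) z = norm z"
    by metis
  \<comment> \<open>A stage is a finite set with a point. The next set takes in the current point,
    all halves and all differences; the next point agrees with \<open>x\<close> up to
    \<open>1 / Suc n\<close> on the norming functionals of the next set. As the sets increase, each
    of these functionals is eventually controlled.\<close>
  define Q where "Q n Za Za' \<longleftrightarrow> fst Za \<subseteq> fst Za' \<and> snd Za \<in> fst Za' \<and>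
      (\<forall>u\<in>fst Za. (1/2) *\<^sub>R u \<in> fst Za' \<and> (\<forall>v\<in>fst Za. u - v \<in> fst Za')) \<and>
      (\<forall>z\<in>fst Za'. \<bar>blinfun_apply (nf z) (snd Za') - blinfun_apply (nf z) x\<bar> < 1 / Suc n)"
    for n :: nat and Za Za' :: "'v set \<times> 'v"
  have "\<exists>Za. \<forall>n. (finite (fst (Za n)) \<and> x \<in> fst (Za n) \<and> snd (Za n) \<in> S n) \<and> Q n (Za n) (Za (Suc n))"
  proof (rule dependent_nat_choice)
    show "\<exists>Za. finite (fst Za) \<and> x \<in> fst Za \<and> snd Za \<in> S 0"
      using cluster[of "{}" 1 0] by (intro exI[of _ "({x}, SOME s. s \<in> S 0)"]) (auto intro: someI)
  next
    fix Za :: "'v set \<times> 'v" and n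
    assume "finite (fst Za) \<and> x \<in> fst Za \<and> snd Za \<in> S n"
    define Z where "Z = fst Za \<union> {snd Za} \<union> (\<lambda>u. (1/2) *\<^sub>R u) ` fst Za \<union> (\<lambda>(u, v). u - v) ` (fst Za \<times> fst Za)"
    have "finite Z" "x \<in> Z" using \<open>finite (fst Za) \<and> _\<close> by (auto simp: Z_def)
    then obtain s where "s \<in> S (Suc n)"
        "\<forall>f\<in>nf ` Z. \<bar>blinfun_apply f s - blinfun_apply f x\<bar> < 1 / Suc n"
      using cluster[of "nf ` Z" "1 / Suc n" "Suc n"] by auto
    then show "\<exists>Za'. (finite (fst Za') \<and> x \<in> fst Za' \<and> snd Za' \<in> S (Suc n)) \<and> Q n Za Za'"
      using \<open>finite Z\<close> \<open>x \<in> Z\<close> by (intro exI[of _ "(Z, s)"]) (force simp: Q_def Z_def)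
  qed
  then obtain Za where Za: "\<And>n. x \<in> fst (Za n)" "\<And>n. snd (Za n) \<in> S n"
      "\<And>n. Q n (Za n) (Za (Suc n))"
    by blast
  define Z where "Z n = fst (Za n)" for n
  define a where "a n = snd (Za n)" for n
  define D where "D = (\<Union>n. Z n)"
  have "incseq Z" using Za(3) by (intro incseq_SucI) (auto simp: Z_def Q_def)
  have diff: "u - v \<in> D" if uv: "u \<in> D" "v \<in> D" for u v
  proof -
    obtain i j where "u \<in> Z i" "v \<in> Z j" using uv by (auto simp: D_def)
    then have "u \<in> Z (max i j)" "v \<in> Z (max i j)"
      using incseqD[OF \<open>incseq Z\<close>, of i "max i j"] incseqD[OF \<open>incseq Z\<close>, of j "max i j"] by auto
    then have "u - v \<in> Z (Suc (max i j))" using Za(3)[of "max i j"] by (auto simp: Q_def Z_def)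
    then show ?thesis by (auto simp: D_def)
  qed
  have half: "(1/2) *\<^sub>R u \<in> D" if "u \<in> D" for u
  proof -
    obtain i where "u \<in> Z i" using \<open>u \<in> D\<close> by (auto simp: D_def)
    then have "(1/2) *\<^sub>R u \<in> Z (Suc i)" using Za(3)[of i] unfolding Q_def Z_def by blast
    then show ?thesis by (auto simp: D_def)
  qed
  have xD: "x \<in> D" using Za(1) by (auto simp: D_def Z_def)
  have aD: "a n \<in> D" for n
  proof -
    have "a n \<in> Z (Suc n)" using Za(3)[of n] by (auto simp: Q_def Z_def a_def)
    then show ?thesis by (auto simp: D_def)
  qed
  have sub: "subspace (closure D)" by (rule subspace_closure_halving) (use xD diff half in auto)
  have lim: "(\<lambda>n. blinfun_apply (nf z) (a n)) \<longlonglongrightarrow> blinfun_apply (nf z) x" if "z \<in> D" for z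
  proof -
    obtain k where k: "z \<in> Z k" using \<open>z \<in> D\<close> by (auto simp: D_def)
    have "\<bar>blinfun_apply (nf z) (a (Suc n)) - blinfun_apply (nf z) x\<bar> \<le> 1 / Suc n" if "n \<ge> k" for n
    proof -
      have "z \<in> Z (Suc n)" using k incseqD[OF \<open>incseq Z\<close>, of k "Suc n"] \<open>n \<ge> k\<close> by auto
      then show ?thesis using Za(3)[of n] unfolding Q_def Z_def a_def by force
    qed
    then have "eventually (\<lambda>n. norm (blinfun_apply (nf z) (a (Suc n)) - blinfun_apply (nf z) x) \<le> 1 / Suc n) sequentially"
      by (auto simp: eventually_sequentially)
    moreover have "(\<lambda>n. 1 / real (Suc n)) \<longlonglongrightarrow> 0"
      using LIMSEQ_inverse_real_of_nat by (simp add: inverse_eq_divide)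
    ultimately have "(\<lambda>n. blinfun_apply (nf z) (a (Suc n)) - blinfun_apply (nf z) x) \<longlonglongrightarrow> 0"
      by (rule Lim_null_comparison)
    then show ?thesis by (simp add: LIM_zero_iff filterlim_sequentially_Suc[of "\<lambda>n. blinfun_apply (nf z) (a n)"])
  qed
  have "weak_conv a x"
    unfolding weak_conv_def
  proof (intro allI, rule ccontr)
    fix f :: "'v \<Rightarrow>\<^sub>L real"
    assume "\<not> (\<lambda>n. blinfun_apply f (a n)) \<longlonglongrightarrow> blinfun_apply f x"
    then obtain e where e: "e > 0" "\<And>N. \<exists>n\<ge>N. \<bar>blinfun_apply f (a n) - blinfun_apply f x\<bar> \<ge> e"
      by (auto simp: LIMSEQ_iff not_less)
    \<comment> \<open>If convergence fails for \<open>f\<close>, these tails have a weak cluster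
      point \<open>y \<noteq> x\<close>. It lies in \<open>closure D\<close> and agrees with
      \<open>x\<close> under \<open>nf z\<close> for all \<open>z \<in> D\<close>, which is
      contradictory.\<close>
    define T where "T N = {a n | n. n \<ge> N \<and> \<bar>blinfun_apply f (a n) - blinfun_apply f x\<bar> \<ge> e}" for N
    obtain y where y: "\<And>n F e. finite F \<Longrightarrow> e > 0 \<Longrightarrow>
        \<exists>s\<in>T n. \<forall>f\<in>F. \<bar>blinfun_apply f s - blinfun_apply f y\<bar> < (e::real)"
    proof (rule weak_cluster_point[OF refl])
      show "T n \<noteq> {}" for n using e(2)[of n] by (auto simp: T_def)
      show "decseq T" by (rule decseq_SucI) (auto simp: T_def)
      show "norm s \<le> R" if "s \<in> T n" for n s
        using that bound Za(2) by (auto simp: T_def a_def)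
    qed blast
    have "y \<noteq> x" using y[of "{f}" e 0] e(1) by (auto simp: T_def)
    have nf_y: "blinfun_apply (nf z) y = blinfun_apply (nf z) x" if "z \<in> D" for z
    proof (rule ccontr)
      define c where "c = \<bar>blinfun_apply (nf z) y - blinfun_apply (nf z) x\<bar> / 2"
      assume "blinfun_apply (nf z) y \<noteq> blinfun_apply (nf z) x"
      then have "c > 0" by (simp add: c_def)
      then obtain N where "\<And>n. n \<ge> N \<Longrightarrow> \<bar>blinfun_apply (nf z) (a n) - blinfun_apply (nf z) x\<bar> < c"
        using lim[OF \<open>z \<in> D\<close>] unfolding LIMSEQ_iff by (metis real_norm_def)
      moreover obtain n where "n \<ge> N" "\<bar>blinfun_apply (nf z) (a n) - blinfun_apply (nf z) y\<bar> < c"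
        using y[of "{nf z}" c N] \<open>c > 0\<close> by (auto simp: T_def)
      ultimately show False unfolding c_def by (smt (verit) field_sum_of_halves)
    qed
    have "y \<in> closure D"
    proof (rule ccontr)
      assume "y \<notin> closure D"
      have ne: "closure D \<noteq> {}" using xD by auto
      obtain g :: "'v \<Rightarrow>\<^sub>L real" where g: "\<And>z. \<bar>blinfun_apply g z\<bar> \<le> norm z"
          "\<And>s. s \<in> closure D \<Longrightarrow> blinfun_apply g y - blinfun_apply g s \<ge> infdist y (closure D)"
        using separation_infdist[OF subspace_imp_convex[OF sub] ne, of y] by blast
      have "infdist y (closure D) > 0"
        using ne \<open>y \<notin> closure D\<close> by (intro infdist_pos_not_in_closed) auto
      then obtain n where "\<bar>blinfun_apply g (a n) - blinfun_apply g y\<bar> < infdist y (closure D)"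
        using y[of "{g}" "infdist y (closure D)" 0] by (auto simp: T_def)
      moreover have "a n \<in> closure D" using aD closure_subset by blast
      ultimately show False using g(2)[of "a n"] by linarith
    qed
    then have "y - x \<in> closure D" using sub xD closure_subset by (intro subspace_diff) auto
    then obtain z where z: "z \<in> D" "dist z (y - x) < norm (y - x) / 2"
      using \<open>y \<noteq> x\<close> unfolding closure_approachable by (metis half_gt_zero right_minus_eq zero_less_norm_iff)
    \<comment> \<open>\<open>nf z\<close> vanishes at \<open>y - x\<close>, so \<open>norm z\<close>
      is at most the distance of \<open>z\<close> from \<open>y - x\<close>. Then
      \<open>norm (y - x)\<close> is at most twice that distance, which was chosen below half of
      it.\<close>
    have "norm z = blinfun_apply (nf z) (z - (y - x))"
      using nf_y[OF z(1)] nf(2)[of z] by (simp add: blinfun.diff_right)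
    also have "\<dots> \<le> norm (z - (y - x))" using nf(1)[of z "z - (y - x)"] by linarith
    finally have "norm z \<le> dist z (y - x)" by (simp add: dist_norm)
    moreover have "norm (y - x) \<le> norm z + dist z (y - x)"
      using norm_triangle_ineq[of z "(y - x) - z"] by (simp add: dist_norm norm_minus_commute)
    ultimately show False using z(2) by simp
  qed
  then show ?thesis using that[of a] Za(2) by (simp add: a_def)
qed

text \<open>If every basic neighbourhood of \<open>x\<close> met \<open>S\<close>, then
  \<open>weak_cluster_sequence\<close> would apply to the constant family
  \<open>\<lambda>_. S\<close>.\<close>

corollary weakly_closed_if_sequentially:
  fixes S :: "'v::banach set"
  assumes refl: "reflexive_space TYPE('v)" and "bounded S"
    and seq: "\<And>xs x. (\<And>n. xs n \<in> S) \<Longrightarrow> weak_conv xs x \<Longrightarrow> x \<in> S"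
  shows "weakly_closed S"
  unfolding weakly_closed_def weakly_open_def
proof (intro ballI, rule ccontr)
  fix x assume "x \<in> - S"
  assume neg: "\<not> (\<exists>F :: ('v \<Rightarrow>\<^sub>L real) set. finite F \<and> (\<exists>e>0.
       {y. \<forall>f\<in>F. \<bar>blinfun_apply f y - blinfun_apply f x\<bar> < e} \<subseteq> - S))"
  obtain R where R: "\<And>s. s \<in> S \<Longrightarrow> norm s \<le> R" using \<open>bounded S\<close> by (auto simp: bounded_iff)
  obtain a where "\<And>n. a n \<in> S" "weak_conv a x"
    by (rule weak_cluster_sequence[OF refl, of "\<lambda>_. S" R x]) (use R neg in blast)+
  then show False using seq \<open>x \<in> - S\<close> by auto
qed

text \<open>Applied to the tails of \<open>ys\<close>, \<open>weak_cluster_sequence\<close> takes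
  its \<open>n\<close>-th term from the \<open>n\<close>-th tail. Hence \<open>k n \<ge> n\<close>,
  and limits pass through \<open>k\<close> although it may fail to be monotone.\<close>

corollary bounded_weak_subsequence:
  fixes ys :: "nat \<Rightarrow> 'v::banach"
  assumes refl: "reflexive_space TYPE('v)" and R: "\<And>n. norm (ys n) \<le> R"
  obtains k y where "filterlim k at_top sequentially" "weak_conv (\<lambda>n. ys (k n)) y"
proof -
  define S where "S n = ys ` {n..}" for n
  obtain y where "\<And>n F e. finite F \<Longrightarrow> e > 0 \<Longrightarrow>
      \<exists>s\<in>S n. \<forall>f\<in>F. \<bar>blinfun_apply f s - blinfun_apply f y\<bar> < (e::real)"
    by (rule weak_cluster_point[OF refl, of S R]) (auto simp: S_def R decseq_def)
  then obtain a where a: "\<And>n. a n \<in> S n" "weak_conv a y"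
    by (rule weak_cluster_sequence[OF refl, of S R y, rotated]) (auto simp: S_def R)
  then have "\<forall>n. \<exists>k\<ge>n. a n = ys k" by (auto simp: S_def)
  then obtain k where k: "\<And>n. k n \<ge> n" "\<And>n. a n = ys (k n)" by metis
  have "filterlim k at_top sequentially"
    by (rule filterlim_at_top_mono[OF filterlim_ident]) (simp add: k(1))
  moreover have "weak_conv (\<lambda>n. ys (k n)) y" using a(2) k(2) by (simp add: weak_conv_def)
  ultimately show ?thesis by (rule that)
qed

section \<open>Weakly closed sets and finite covers\<close>

lemma weakly_closed_neighbourhood:
  assumes "weakly_closed S" "x \<notin> S"
  obtains F :: "('v::real_normed_vector \<Rightarrow>\<^sub>L real) set" and e
  where "finite F" "e > 0"
    "\<And>y. \<forall>f\<in>F. \<bar>blinfun_apply f y - blinfun_apply f x\<bar> < e \<Longrightarrow> y \<notin> S"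
proof -
  have "\<exists>F :: ('v \<Rightarrow>\<^sub>L real) set. finite F \<and> (\<exists>e>0.
      {y. \<forall>f\<in>F. \<bar>blinfun_apply f y - blinfun_apply f x\<bar> < e} \<subseteq> - S)"
    using assms unfolding weakly_closed_def weakly_open_def by simp
  then obtain F :: "('v \<Rightarrow>\<^sub>L real) set" and e where "finite F" "e > 0"
    "{y. \<forall>f\<in>F. \<bar>blinfun_apply f y - blinfun_apply f x\<bar> < e} \<subseteq> - S"
    by (elim exE conjE)
  then show ?thesis using that[of F e] by auto
qed

lemma weakly_closed_closed_convex:
  fixes W :: "'v::banach set"
  assumes refl: "reflexive_space TYPE('v)" and W: "convex W" "closed W" "bounded W"
  shows "weakly_closed W"
  using weakly_closed_if_sequentially[OF refl W(3)] weak_conv_closed_convex[OF W(2,1)] by blast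

lemma weak_compactness_weakly_closed:
  fixes W :: "'v::banach set"
  assumes refl: "reflexive_space TYPE('v)"
    and W: "weakly_closed W" "bounded W"
    and A: "\<And>w. w \<in> W \<Longrightarrow> weakly_closed (A w) \<and> w \<notin> A w"
  obtains Y F and e :: "'v \<Rightarrow> real" where "finite Y" "Y \<subseteq> W"
    "\<And>w. w \<in> W \<Longrightarrow> finite (F w)"
    "\<And>w z. w \<in> W \<Longrightarrow> \<forall>f\<in>F w. \<bar>blinfun_apply f z - blinfun_apply f w\<bar> < e w \<Longrightarrow> z \<notin> A w"
    "\<And>z. z \<in> W \<Longrightarrow> \<exists>w\<in>Y. \<forall>f\<in>F w. \<bar>blinfun_apply f z - blinfun_apply f w\<bar> < e w"
proof -
  define A' where "A' w = (if w \<in> W then A w else W)" for w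
  have "\<exists>F e. finite F \<and> e > (0::real) \<and>
      (\<forall>z. (\<forall>f\<in>F. \<bar>blinfun_apply f z - blinfun_apply f w\<bar> < e) \<longrightarrow> z \<notin> A' w)" for w
  proof -
    have "weakly_closed (A' w)" "w \<notin> A' w" using A W by (auto simp: A'_def)
    then obtain F and e :: real where "finite F" "e > 0"
        "\<And>z. \<forall>f\<in>F. \<bar>blinfun_apply f z - blinfun_apply f w\<bar> < e \<Longrightarrow> z \<notin> A' w"
      by (rule weakly_closed_neighbourhood) (rule that)
    then show ?thesis by (intro exI[of _ F] exI[of _ e] conjI allI impI)
  qed
  then obtain F e where Fe: "\<And>w. finite (F w) \<and> e w > (0::real)"
      "\<And>w z. (\<forall>f\<in>F w. \<bar>blinfun_apply f z - blinfun_apply f w\<bar> < e w) \<Longrightarrow> z \<notin> A' w"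
    by metis
  obtain R where R: "\<And>w. w \<in> W \<Longrightarrow> norm w \<le> R" using W(2) by (auto simp: bounded_iff)
  obtain Y where Y: "finite Y"
      "\<And>z. norm z \<le> R \<Longrightarrow> \<exists>w\<in>Y. \<forall>f\<in>F w. \<bar>blinfun_apply f z - blinfun_apply f w\<bar> < e w"
    by (rule weak_compactness[OF refl, of R F e]) (use Fe(1) in auto)
  show ?thesis
  proof (rule that[of "Y \<inter> W" F e])
    show "\<exists>w\<in>Y \<inter> W. \<forall>f\<in>F w. \<bar>blinfun_apply f z - blinfun_apply f w\<bar> < e w" if "z \<in> W" for z
    proof -
      obtain w where w: "w \<in> Y" "\<forall>f\<in>F w. \<bar>blinfun_apply f z - blinfun_apply f w\<bar> < e w"
        using Y(2)[OF R[OF \<open>z \<in> W\<close>]] by blast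
      have "z \<notin> A' w" by (rule Fe(2)[OF w(2)])
      then have "w \<in> W" using that by (auto simp: A'_def split: if_splits)
      then show ?thesis using w by blast
    qed
    show "z \<notin> A w" if "w \<in> W"
      "\<forall>f\<in>F w. \<bar>blinfun_apply f z - blinfun_apply f w\<bar> < e w" for w z
      using Fe(2)[of w z] that by (auto simp: A'_def)
  qed (use Y(1) Fe(1) in auto)
qed

subsection \<open>Brouwer's theorem and the inequality of Ky Fan\<close>

text \<open>Points vanish from \<open>n\<close> on, so cubes of all dimensions live in one type and
  are compact as products.\<close>

definition unit_cube :: "nat \<Rightarrow> (nat \<Rightarrow> real) set" where
  "unit_cube n = Pi UNIV (\<lambda>i. if i < n then {0..1} else {0})"

lemma compact_unit_cube: "compact (unit_cube n)"
  unfolding unit_cube_def by (rule compact_Pi_UNIV) simp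

lemma unit_cubeD: "x \<in> unit_cube n \<Longrightarrow> 0 \<le> x i \<and> x i \<le> 1"
  by (auto simp: unit_cube_def Pi_iff dest: spec[of _ i] split: if_splits)

lemma tendsto_fun_coordinatewise:
  fixes X :: "nat \<Rightarrow> 'i \<Rightarrow> 'a::topological_space"
  shows "X \<longlonglongrightarrow> x \<longleftrightarrow> (\<forall>i. (\<lambda>k. X k i) \<longlonglongrightarrow> x i)"
  using limitin_componentwise[of "\<lambda>_. euclidean" UNIV X x sequentially]
  by (simp add: euclidean_product_topology)

text \<open>The dimension is a term here, unlike in the library version for Euclidean spaces; both rest on
  Kuhn's combinatorial lemma.\<close>

theorem brouwer_unit_cube:
  fixes f :: "(nat \<Rightarrow> real) \<Rightarrow> nat \<Rightarrow> real"
  assumes cont: "\<And>i. continuous_on (unit_cube n) (\<lambda>x. f x i)"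
    and f: "f ` unit_cube n \<subseteq> unit_cube n"
  obtains x where "x \<in> unit_cube n" "f x = x"
proof -
  have P: "\<forall>x. x \<in> unit_cube n \<longrightarrow> f x \<in> unit_cube n" using f by auto
  have Q: "\<forall>x. x \<in> unit_cube n \<longrightarrow> (\<forall>i. i < n \<longrightarrow> 0 \<le> x i \<and> x i \<le> 1)"
    using unit_cubeD by blast
  obtain l :: "(nat \<Rightarrow> real) \<Rightarrow> nat \<Rightarrow> nat" where l: "\<And>x i. l x i \<le> 1"
      "\<And>x i. x \<in> unit_cube n \<Longrightarrow> i < n \<Longrightarrow> x i = 0 \<Longrightarrow> l x i = 0"
      "\<And>x i. x \<in> unit_cube n \<Longrightarrow> i < n \<Longrightarrow> x i = 1 \<Longrightarrow> l x i = 1"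
      "\<And>x i. x \<in> unit_cube n \<Longrightarrow> i < n \<Longrightarrow> l x i = 0 \<Longrightarrow> x i \<le> f x i"
      "\<And>x i. x \<in> unit_cube n \<Longrightarrow> i < n \<Longrightarrow> l x i = 1 \<Longrightarrow> f x i \<le> x i"
    using kuhn_labelling_lemma'[OF P Q] by blast
  define emb where "emb k q i = (if i < n then real (q i) / real (Suc k) else 0)"
    for k :: nat and q :: "nat \<Rightarrow> nat" and i
  have emb: "emb k q \<in> unit_cube n" if "\<And>i. i < n \<Longrightarrow> q i \<le> Suc k" for k q
    using that by (auto simp: emb_def unit_cube_def divide_le_eq_1 simp flip: of_nat_Suc)
  \<comment> \<open>Near \<open>x\<close> there are, for each coordinate \<open>i < n\<close>, a
    point \<open>R i\<close> where \<open>f\<close> does not decrease this coordinate and a point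
    \<open>S i\<close> where \<open>f\<close> does not increase it. As the mesh shrinks, both tend
    to the limit of the \<open>x\<close>, which is therefore fixed.\<close>
  define approx where "approx k x R S \<longleftrightarrow> x \<in> unit_cube n \<and>
      (\<forall>i<n. R i \<in> unit_cube n \<and> S i \<in> unit_cube n \<and>
        (\<forall>j. \<bar>R i j - x j\<bar> \<le> 1 / Suc k) \<and> (\<forall>j. \<bar>S i j - x j\<bar> \<le> 1 / Suc k) \<and>
        R i i \<le> f (R i) i \<and> f (S i) i \<le> S i i)"
    for k :: nat and x and R S :: "nat \<Rightarrow> nat \<Rightarrow> real"
  have "\<exists>x R S. approx k x R S" for k
  proof -
    define label where "label q = l (emb k q)" for q
    obtain q where q: "\<forall>i<n. q i < Suc k"
      "\<forall>i<n. \<exists>r s. (\<forall>j<n. q j \<le> r j \<and> r j \<le> q j + 1) \<and> (\<forall>j<n. q j \<le> s j \<and> s j \<le> q j + 1)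
        \<and> label r i \<noteq> label s i"
    proof (rule kuhn_lemma[of "Suc k" n label])
      show "\<forall>x. (\<forall>i<n. x i \<le> Suc k) \<longrightarrow> (\<forall>i<n. label x i = 0 \<or> label x i = 1)"
        using l(1) by (metis label_def less_one nat_less_le)
      show "\<forall>x. (\<forall>i<n. x i \<le> Suc k) \<longrightarrow> (\<forall>i<n. x i = 0 \<longrightarrow> label x i = 0)"
        unfolding label_def by (intro allI impI l(2) emb) (auto simp: emb_def)
      show "\<forall>x. (\<forall>i<n. x i \<le> Suc k) \<longrightarrow> (\<forall>i<n. x i = Suc k \<longrightarrow> label x i = 1)"
        unfolding label_def by (intro allI impI l(3) emb) (auto simp: emb_def)
    qed auto
    have near: "emb k r \<in> unit_cube n \<and> (\<forall>j. \<bar>emb k r j - emb k q j\<bar> \<le> 1 / Suc k)"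
      if r: "\<forall>j<n. q j \<le> r j \<and> r j \<le> q j + 1" for r
    proof (intro conjI allI emb)
      show "r i \<le> Suc k" if "i < n" for i using r q(1) that by (metis Suc_eq_plus1 Suc_leI le_trans)
      show "\<bar>emb k r j - emb k q j\<bar> \<le> 1 / Suc k" for j
      proof (cases "j < n")
        case True
        then have "\<bar>real (r j) - real (q j)\<bar> \<le> 1" using r by force
        then show ?thesis using True
          by (simp add: emb_def divide_right_mono abs_divide flip: diff_divide_distrib)
      qed (simp add: emb_def)
    qed
    have "\<forall>i. \<exists>R S. i < n \<longrightarrow> R \<in> unit_cube n \<and> S \<in> unit_cube n \<and>
      (\<forall>j. \<bar>R j - emb k q j\<bar> \<le> 1 / Suc k) \<and> (\<forall>j. \<bar>S j - emb k q j\<bar> \<le> 1 / Suc k) \<and>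
      R i \<le> f R i \<and> f S i \<le> S i"
    proof (intro allI)
      fix i
      show "\<exists>R S. i < n \<longrightarrow> R \<in> unit_cube n \<and> S \<in> unit_cube n \<and>
        (\<forall>j. \<bar>R j - emb k q j\<bar> \<le> 1 / Suc k) \<and> (\<forall>j. \<bar>S j - emb k q j\<bar> \<le> 1 / Suc k) \<and>
        R i \<le> f R i \<and> f S i \<le> S i"
      proof (cases "i < n")
        case True
        then obtain r s where rs: "\<forall>j<n. q j \<le> r j \<and> r j \<le> q j + 1"
            "\<forall>j<n. q j \<le> s j \<and> s j \<le> q j + 1" "label r i \<noteq> label s i"
          using q(2) by blast
        \<comment> \<open>The vertex labelled 0 becomes \<open>R\<close> and the one labelled 1
          becomes \<open>S\<close>.\<close>
        consider "label r i = 0" "label s i = 1" | "label r i = 1" "label s i = 0"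
          using rs(3) l(1)[of "emb k r" i] l(1)[of "emb k s" i] unfolding label_def by linarith
        then show ?thesis
        proof cases
          case 1
          then show ?thesis using near[OF rs(1)] near[OF rs(2)] l(4,5) True unfolding label_def by blast
        next
          case 2
          then show ?thesis using near[OF rs(1)] near[OF rs(2)] l(4,5) True unfolding label_def by blast
        qed
      qed simp
    qed
    then obtain R S where "\<forall>i. i < n \<longrightarrow> R i \<in> unit_cube n \<and> S i \<in> unit_cube n \<and>
      (\<forall>j. \<bar>R i j - emb k q j\<bar> \<le> 1 / Suc k) \<and> (\<forall>j. \<bar>S i j - emb k q j\<bar> \<le> 1 / Suc k) \<and>
      R i i \<le> f (R i) i \<and> f (S i) i \<le> S i i"
      by metis
    moreover have "emb k q \<in> unit_cube n" using q(1) by (intro emb) (simp add: less_imp_le)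
    ultimately show ?thesis unfolding approx_def by blast
  qed
  then obtain X R S where "\<And>k. approx k (X k) (R k) (S k)" by metis
  then have X: "\<And>k. X k \<in> unit_cube n"
    and R: "\<And>k i. i < n \<Longrightarrow> R k i \<in> unit_cube n" "\<And>k i j. i < n \<Longrightarrow> \<bar>R k i j - X k j\<bar> \<le> 1 / Suc k"
      "\<And>k i. i < n \<Longrightarrow> R k i i \<le> f (R k i) i"
    and S: "\<And>k i. i < n \<Longrightarrow> S k i \<in> unit_cube n" "\<And>k i j. i < n \<Longrightarrow> \<bar>S k i j - X k j\<bar> \<le> 1 / Suc k"
      "\<And>k i. i < n \<Longrightarrow> f (S k i) i \<le> S k i i"
    by (simp_all add: approx_def)
  obtain x \<rho> where x: "x \<in> unit_cube n" "strict_mono (\<rho> :: nat \<Rightarrow> nat)" "(X \<circ> \<rho>) \<longlonglongrightarrow> x"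
    using compact_unit_cube[of n] X unfolding compact_eq_seq_compact_metric seq_compact_def by blast
  have inv: "(\<lambda>k. 1 / real (Suc (\<rho> k))) \<longlonglongrightarrow> 0"
    using LIMSEQ_subseq_LIMSEQ[OF LIMSEQ_inverse_real_of_nat x(2)]
    by (simp add: o_def inverse_eq_divide)
  have conv: "(\<lambda>k. Y (\<rho> k)) \<longlonglongrightarrow> x" if Y: "\<And>k j. \<bar>Y k j - X k j\<bar> \<le> 1 / Suc k" for Y :: "nat \<Rightarrow> nat \<Rightarrow> real"
    unfolding tendsto_fun_coordinatewise
  proof
    fix j
    have "(\<lambda>k. Y (\<rho> k) j - X (\<rho> k) j) \<longlonglongrightarrow> 0"
      by (rule Lim_null_comparison[OF _ inv]) (intro always_eventually allI, simp only: real_norm_def Y)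
    moreover have "(\<lambda>k. X (\<rho> k) j) \<longlonglongrightarrow> x j"
      using x(3) unfolding tendsto_fun_coordinatewise o_def by blast
    ultimately show "(\<lambda>k. Y (\<rho> k) j) \<longlonglongrightarrow> x j" using tendsto_add by fastforce
  qed
  have "f x i = x i" if i: "i < n" for i
  proof (rule antisym)
    have lim: "(\<lambda>k. R (\<rho> k) i) \<longlonglongrightarrow> x" by (rule conv) (rule R(2)[OF i])
    then have "(\<lambda>k. R (\<rho> k) i i) \<longlonglongrightarrow> x i" unfolding tendsto_fun_coordinatewise by blast
    moreover have "(\<lambda>k. f (R (\<rho> k) i) i) \<longlonglongrightarrow> f x i"
      by (rule continuous_on_tendsto_compose[OF cont lim x(1)]) (simp add: R(1)[OF i])
    ultimately show "x i \<le> f x i" using R(3)[OF i] by (intro LIMSEQ_le) auto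
    have lim: "(\<lambda>k. S (\<rho> k) i) \<longlonglongrightarrow> x" by (rule conv) (rule S(2)[OF i])
    then have "(\<lambda>k. S (\<rho> k) i i) \<longlonglongrightarrow> x i" unfolding tendsto_fun_coordinatewise by blast
    moreover have "(\<lambda>k. f (S (\<rho> k) i) i) \<longlonglongrightarrow> f x i"
      by (rule continuous_on_tendsto_compose[OF cont lim x(1)]) (simp add: S(1)[OF i])
    ultimately show "f x i \<le> x i" using S(3)[OF i] by (intro LIMSEQ_le) auto
  qed
  moreover have "f x i = x i" if "\<not> i < n" for i
  proof -
    have "f x \<in> unit_cube n" using P x(1) by blast
    then have "f x i = 0" "x i = 0" using x(1) that by (auto simp: unit_cube_def Pi_iff dest: spec[of _ i])
    then show ?thesis by simp
  qed
  ultimately have "f x = x" by blast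
  then show ?thesis using that x(1) by blast
qed

section \<open>Complementarity on simplices and Ky Fan's inequality\<close>

definition std_simplex :: "nat \<Rightarrow> (nat \<Rightarrow> real) set" where
  "std_simplex n = {x. (\<forall>i. 0 \<le> x i) \<and> (\<forall>i\<ge>n. x i = 0) \<and> (\<Sum>i<n. x i) = 1}"

text \<open>Nash's map, precomposed with a retraction of the cube onto the simplex.\<close>

theorem simplex_complementarity:
  fixes g :: "nat \<Rightarrow> (nat \<Rightarrow> real) \<Rightarrow> real"
  assumes n: "n > 0"
    and cont: "\<And>i. i < n \<Longrightarrow> continuous_on (std_simplex n) (g i)"
    and le: "\<And>x. x \<in> std_simplex n \<Longrightarrow> (\<Sum>i<n. x i * g i x) \<le> 0"
  obtains x where "x \<in> std_simplex n" "\<And>i. i < n \<Longrightarrow> g i x \<le> 0"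
proof -
  define s where "s x = (\<Sum>i<n. x i)" for x :: "nat \<Rightarrow> real"
  \<comment> \<open>A coordinate sum above 1 is divided out, and a deficit below 1 is shared
    equally; points of the simplex stay put.\<close>
  define r where "r x i = (if i < n then x i / max 1 (s x) + max 0 (1 - s x) / n else 0)" for x i
  have s_nonneg: "s x \<ge> 0" if "x \<in> unit_cube n" for x
    unfolding s_def using that unit_cubeD by (intro sum_nonneg) blast
  have r_simplex: "r x \<in> std_simplex n" if x: "x \<in> unit_cube n" for x
  proof -
    have "(\<Sum>i<n. r x i) = (\<Sum>i<n. x i / max 1 (s x) + max 0 (1 - s x) / n)"
      by (intro sum.cong) (auto simp: r_def)
    also have "\<dots> = s x / max 1 (s x) + max 0 (1 - s x)"
      using n by (simp add: sum.distrib s_def flip: sum_divide_distrib)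
    also have "\<dots> = 1" by (auto simp: max_def)
    finally show ?thesis using unit_cubeD[OF x] by (auto simp: std_simplex_def r_def)
  qed
  have sub: "std_simplex n \<subseteq> unit_cube n"
  proof
    fix x assume x: "x \<in> std_simplex n"
    have "x i \<le> 1" if "i < n" for i
    proof -
      have "x i \<le> (\<Sum>i<n. x i)"
        using x that by (intro member_le_sum) (auto simp: std_simplex_def)
      then show ?thesis using x by (simp add: std_simplex_def)
    qed
    then show "x \<in> unit_cube n" using x by (auto simp: std_simplex_def unit_cube_def)
  qed
  have r_id: "r x = x" if "x \<in> std_simplex n" for x
  proof -
    have "s x = 1" using that by (simp add: s_def std_simplex_def)
    then show ?thesis using that by (auto simp: r_def std_simplex_def fun_eq_iff)
  qed
  define G where "G x = (\<Sum>i<n. max 0 (g i x))" for x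
  have G0: "G x \<ge> 0" for x unfolding G_def by (intro sum_nonneg) simp
  define f where "f x i = (if i < n then (r x i + max 0 (g i (r x))) / (1 + G (r x)) else 0)" for x i
  have f_simplex: "f x \<in> std_simplex n" if "x \<in> unit_cube n" for x
  proof -
    have pos: "1 + G (r x) > 0" using G0[of "r x"] by linarith
    have "(\<Sum>i<n. f x i) = (\<Sum>i<n. (r x i + max 0 (g i (r x))) / (1 + G (r x)))"
      by (intro sum.cong) (auto simp: f_def)
    also have "\<dots> = ((\<Sum>i<n. r x i) + G (r x)) / (1 + G (r x))"
      by (simp add: G_def sum.distrib flip: sum_divide_distrib)
    also have "\<dots> = 1" using r_simplex[OF that] pos by (simp add: std_simplex_def)
    finally show ?thesis using r_simplex[OF that] pos by (auto simp: std_simplex_def f_def)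
  qed
  have coord: "continuous_on A (\<lambda>x. x i)" for A :: "(nat \<Rightarrow> real) set" and i
    by (rule continuous_on_subset[OF continuous_on_product_coordinates]) simp
  have cont_r: "continuous_on (unit_cube n) (\<lambda>x. r x i)" for i
  proof (cases "i < n")
    case True
    have "continuous_on (unit_cube n) (\<lambda>x. x i / max 1 (s x) + max 0 (1 - s x) / n)"
      unfolding s_def using n by (intro continuous_intros coord) auto
    then show ?thesis using True by (simp add: r_def)
  qed (simp add: r_def)
  have cont_gr: "continuous_on (unit_cube n) (\<lambda>x. g i (r x))" if "i < n" for i
    by (rule continuous_on_compose2[OF cont[OF that]])
      (use r_simplex cont_r in \<open>auto intro: continuous_on_coordinatewise_then_product\<close>)
  have cont_f: "continuous_on (unit_cube n) (\<lambda>x. f x i)" for i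
  proof (cases "i < n")
    case True
    have ne: "1 + (\<Sum>j<n. max 0 (g j (r x))) \<noteq> 0" for x using G0[of "r x"] by (simp add: G_def)
    have "continuous_on (unit_cube n) (\<lambda>x. (r x i + max 0 (g i (r x))) / (1 + (\<Sum>j<n. max 0 (g j (r x)))))"
      using True ne by (intro continuous_intros cont_r cont_gr) auto
    then show ?thesis using True by (simp add: f_def G_def)
  qed (simp add: f_def)
  obtain x where x: "x \<in> unit_cube n" "f x = x"
    by (rule brouwer_unit_cube[of n f]) (use cont_f f_simplex sub in blast)+
  have xs: "x \<in> std_simplex n" using f_simplex[OF x(1)] x(2) by simp
  have fix_eq: "x i * G x = max 0 (g i x)" if "i < n" for i
  proof -
    have "x i = (x i + max 0 (g i x)) / (1 + G x)"
      using x(2) r_id[OF xs] that by (metis f_def)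
    then have "x i * (1 + G x) = x i + max 0 (g i x)"
      using G0[of x] by (simp add: eq_divide_eq split: if_splits)
    then show ?thesis by (simp add: algebra_simps)
  qed
  \<comment> \<open>If \<open>G x > 0\<close>, then by \<open>fix_eq\<close> each \<open>i\<close>
    with \<open>x i > 0\<close> has \<open>g i x > 0\<close>, and the sum in \<open>le\<close> would
    be positive.\<close>
  have "G x = 0"
  proof (rule ccontr)
    assume "G x \<noteq> 0"
    then have Gp: "G x > 0" using G0[of x] by linarith
    have x0: "x i \<ge> 0" for i using xs by (simp add: std_simplex_def)
    have pos: "x i * g i x > 0" if "i < n" "x i \<noteq> 0" for i
    proof -
      have "x i > 0" using x0[of i] that(2) by simp
      then have "max 0 (g i x) > 0" using fix_eq[OF that(1)] Gp by (metis mult_pos_pos)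
      then show ?thesis using \<open>x i > 0\<close> by simp
    qed
    have "\<exists>i<n. x i \<noteq> 0"
    proof (rule ccontr)
      assume "\<not> (\<exists>i<n. x i \<noteq> 0)"
      then have "(\<Sum>i<n. x i) = 0" by simp
      then show False using xs by (simp add: std_simplex_def)
    qed
    then obtain i where i: "i < n" "x i \<noteq> 0" by blast
    have "(\<Sum>i<n. x i * g i x) > 0"
    proof (rule sum_pos2[of _ i])
      show "0 \<le> x j * g j x" if "j \<in> {..<n}" for j
        using pos[of j] that by (cases "x j = 0") auto
    qed (use i pos in auto)
    then show False using le[OF xs] by simp
  qed
  then have "g i x \<le> 0" if "i < n" for i using fix_eq[OF that] by simp
  then show ?thesis using that xs by blast
qed

text \<open>Barycentric coordinates over an enumeration of \<open>Y\<close> carry the claim to the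
  simplex, where \<open>le\<close> becomes the sign condition of
  \<open>simplex_complementarity\<close>.\<close>

lemma convex_hull_complementarity:
  fixes G :: "'v::real_normed_vector \<Rightarrow> 'v \<Rightarrow> real"
  assumes W: "convex W" and Y: "finite Y" "Y \<noteq> {}" "Y \<subseteq> W"
    and cont: "\<And>y. y \<in> Y \<Longrightarrow> continuous_on W (G y)"
    and le: "\<And>l. (\<And>y. y \<in> Y \<Longrightarrow> l y \<ge> 0) \<Longrightarrow> sum l Y = 1 \<Longrightarrow>
      (\<Sum>y\<in>Y. l y * G y (\<Sum>y\<in>Y. l y *\<^sub>R y)) \<le> 0"
  obtains u where "u \<in> W" "\<And>y. y \<in> Y \<Longrightarrow> G y u \<le> 0"
proof -
  define n where "n = card Y"
  obtain e where e: "bij_betw e {..<n} Y"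
    using ex_bij_betw_nat_finite[OF Y(1)] by (auto simp: n_def atLeast0LessThan)
  have eY: "e i \<in> Y" if "i < n" for i using e that by (auto simp: bij_betw_def)
  define u where "u x = (\<Sum>i<n. x i *\<^sub>R e i)" for x :: "nat \<Rightarrow> real"
  have uW: "u x \<in> W" if "x \<in> std_simplex n" for x
    unfolding u_def using that eY Y(3) by (intro convex_sum[OF _ W]) (auto simp: std_simplex_def)
  have coord: "continuous_on A (\<lambda>x. x i)" for A :: "(nat \<Rightarrow> real) set" and i
    by (rule continuous_on_subset[OF continuous_on_product_coordinates]) simp
  have cont_u: "continuous_on (std_simplex n) u"
    unfolding u_def by (intro continuous_intros coord)
  obtain x where x: "x \<in> std_simplex n" "\<And>i. i < n \<Longrightarrow> G (e i) (u x) \<le> 0"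
  proof (rule simplex_complementarity[of n "\<lambda>i x. G (e i) (u x)"])
    show "n > 0" using Y by (simp add: n_def card_gt_0_iff)
    show "continuous_on (std_simplex n) (\<lambda>x. G (e i) (u x))" if "i < n" for i
      by (rule continuous_on_compose2[OF cont[OF eY[OF that]] cont_u]) (use uW in auto)
    fix x assume x: "x \<in> std_simplex n"
    define l where "l y = x (inv_into {..<n} e y)" for y
    have l: "l (e i) = x i" if "i < n" for i
      unfolding l_def using e that by (simp add: bij_betw_def)
    have tr: "(\<Sum>i<n. h (x i) (e i)) = (\<Sum>y\<in>Y. h (l y) y)" for h :: "real \<Rightarrow> 'v \<Rightarrow> 'w::comm_monoid_add"
      using sum.reindex_bij_betw[OF e, of "\<lambda>y. h (l y) y"] l by simp
    have "(\<Sum>y\<in>Y. l y * G y (\<Sum>y\<in>Y. l y *\<^sub>R y)) \<le> 0"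
    proof (rule le)
      show "l y \<ge> 0" if "y \<in> Y" for y using x by (simp add: l_def std_simplex_def)
      show "sum l Y = 1" using tr[of "\<lambda>a _. a"] x by (simp add: std_simplex_def)
    qed
    moreover have "u x = (\<Sum>y\<in>Y. l y *\<^sub>R y)" unfolding u_def by (rule tr)
    ultimately show "(\<Sum>i<n. x i * G (e i) (u x)) \<le> 0"
      using tr[of "\<lambda>a y. a * G y (u x)"] by simp
  qed blast
  show ?thesis
  proof (rule that[OF uW[OF x(1)]])
    fix y assume "y \<in> Y"
    then obtain i where "i < n" "y = e i" using e by (auto simp: bij_betw_def)
    then show "G y (u x) \<le> 0" using x(2) by simp
  qed
qed

text \<open>If every \<open>u\<close> had a \<open>y\<close> with \<open>G y u > 0\<close>, weak
  compactness would reduce these \<open>y\<close> to finitely many, against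
  \<open>convex_hull_complementarity\<close>. Norm continuity \<open>cont\<close> serves Brouwer's
  theorem, while \<open>seq\<close> makes the sets with \<open>G y u \<le> 0\<close> weakly closed.
  The averaged condition \<open>le\<close> stands in for concavity in \<open>y\<close> with
  \<open>G u u \<le> 0\<close>.\<close>

theorem ky_fan_weak:
  fixes G :: "'v::banach \<Rightarrow> 'v \<Rightarrow> real"
  assumes refl: "reflexive_space TYPE('v)"
    and W: "convex W" "closed W" "bounded W" "W \<noteq> {}"
    and cont: "\<And>y. y \<in> W \<Longrightarrow> continuous_on W (G y)"
    and seq: "\<And>y us u. y \<in> W \<Longrightarrow> (\<And>n. us n \<in> W) \<Longrightarrow> weak_conv us u \<Longrightarrow> u \<in> W \<Longrightarrow>
      (\<And>n. G y (us n) \<le> 0) \<Longrightarrow> G y u \<le> 0"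
    and le: "\<And>Y l. finite Y \<Longrightarrow> Y \<subseteq> W \<Longrightarrow> (\<And>y. y \<in> Y \<Longrightarrow> l y \<ge> 0) \<Longrightarrow> sum l Y = 1 \<Longrightarrow>
      (\<Sum>y\<in>Y. l y * G y (\<Sum>y\<in>Y. l y *\<^sub>R y)) \<le> 0"
  obtains u where "u \<in> W" "\<And>y. y \<in> W \<Longrightarrow> G y u \<le> 0"
proof (rule ccontr)
  assume "\<not> thesis"
  then have "\<forall>u\<in>W. \<exists>y\<in>W. G y u > 0" using that by (meson not_le)
  then obtain yy where yy: "\<And>u. u \<in> W \<Longrightarrow> yy u \<in> W \<and> G (yy u) u > 0" by metis
  define A where "A v = {u \<in> W. G (yy v) u \<le> 0}" for v
  have wc: "weakly_closed W" by (rule weakly_closed_closed_convex[OF refl W(1-3)])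
  have A: "weakly_closed (A v) \<and> v \<notin> A v" if v: "v \<in> W" for v
  proof
    show "weakly_closed (A v)"
    proof (rule weakly_closed_if_sequentially[OF refl])
      show "bounded (A v)" using W(3) by (rule bounded_subset) (auto simp: A_def)
      show "x \<in> A v" if xs: "\<And>n. xs n \<in> A v" "weak_conv xs x" for xs x
      proof -
        have xsW: "xs n \<in> W" for n using xs(1) by (simp add: A_def)
        have "x \<in> W" by (rule weak_conv_closed_convex[OF W(2,1) xsW xs(2)])
        moreover have "G (yy v) x \<le> 0"
          by (rule seq[OF _ xsW xs(2) \<open>x \<in> W\<close>]) (use yy[OF v] xs(1) in \<open>auto simp: A_def\<close>)
        ultimately show ?thesis by (simp add: A_def)
      qed
    qed
    show "v \<notin> A v" using yy[OF v] by (auto simp: A_def)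
  qed
  obtain Y F and e :: "'v \<Rightarrow> real" where Y: "finite Y" "Y \<subseteq> W" and "\<And>w. w \<in> W \<Longrightarrow> finite (F w)"
    and excl: "\<And>w z. w \<in> W \<Longrightarrow>
      \<forall>f\<in>F w. \<bar>blinfun_apply f z - blinfun_apply f w\<bar> < e w \<Longrightarrow> z \<notin> A w"
    and cov: "\<And>z. z \<in> W \<Longrightarrow> \<exists>w\<in>Y. \<forall>f\<in>F w. \<bar>blinfun_apply f z - blinfun_apply f w\<bar> < e w"
    using weak_compactness_weakly_closed[OF refl wc W(3) A] that by blast
  have "Y \<noteq> {}" using cov W(4) by blast
  obtain u where u: "u \<in> W" "\<And>y. y \<in> yy ` Y \<Longrightarrow> G y u \<le> 0"
  proof (rule convex_hull_complementarity[OF W(1), of "yy ` Y" G])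
    show "yy ` Y \<subseteq> W" using yy Y(2) by auto
    show "continuous_on W (G y)" if "y \<in> yy ` Y" for y using that cont yy Y(2) by blast
    show "(\<Sum>y\<in>yy ` Y. l y * G y (\<Sum>y\<in>yy ` Y. l y *\<^sub>R y)) \<le> 0"
      if "\<And>y. y \<in> yy ` Y \<Longrightarrow> 0 \<le> l y" "sum l (yy ` Y) = 1" for l
      by (rule le) (use that Y yy in auto)
  qed (use Y \<open>Y \<noteq> {}\<close> in auto)
  obtain w where w: "w \<in> Y" "\<forall>f\<in>F w. \<bar>blinfun_apply f u - blinfun_apply f w\<bar> < e w"
    using cov[OF u(1)] by blast
  then have "u \<notin> A w" using excl Y(2) by blast
  then show False using u w(1) by (auto simp: A_def)
qed

subsection \<open>Quasi-variational inequalities for real-valued convex functions\<close>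

text \<open>The convex function enters as a real-valued \<open>p\<close> continuous on
  \<open>C\<close>; \<open>continuous_on_interior_dom\<close> provides this continuity, as
  \<open>C\<close> lies in the interior of the domain.\<close>

locale quasi_variational =
  fixes C :: "'v::banach set" and S :: "'v \<Rightarrow> 'v \<Rightarrow>\<^sub>L real" and p :: "'v \<Rightarrow> real" and K :: "'v \<Rightarrow> 'v set"
  assumes refl: "reflexive_space TYPE('v)"
    and C: "C \<noteq> {}" "closed C" "convex C"
    and S_mono: "monotone_op S"
    and S_cont: "continuous_on UNIV S"
    and p_convex: "convex_on C p"
    and p_cont: "continuous_on C p"
    and K_sub: "\<And>u. u \<in> C \<Longrightarrow> K u \<subseteq> C \<and> K u \<noteq> {} \<and> closed (K u) \<and> convex (K u)"
    and K_lower: "\<And>xs x y. (\<forall>n. xs n \<in> C) \<Longrightarrow> x \<in> C \<Longrightarrow> weak_conv xs x \<Longrightarrow> y \<in> K x \<Longrightarrow>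
               \<exists>ys. (\<forall>n. ys n \<in> C \<and> ys n \<in> K (xs n)) \<and> ys \<longlonglongrightarrow> y"
    and K_upper: "\<And>xs ys x y. (\<forall>n. xs n \<in> C \<and> ys n \<in> C \<and> ys n \<in> K (xs n)) \<Longrightarrow>
               weak_conv xs x \<Longrightarrow> weak_conv ys y \<Longrightarrow> y \<in> K x"
begin

definition stampacchia_gap :: "'v \<Rightarrow> 'v \<Rightarrow> real" where
  "stampacchia_gap u y = blinfun_apply (S u) (y - u) + p y - p u"

text \<open>With \<open>S\<close> at the test point, everything except \<open>- p u\<close> is
  weakly continuous in \<open>u\<close>. In \<open>stampacchia_gap\<close> a weakly convergent
  \<open>u\<close> would also move \<open>S u\<close>.\<close>

definition minty_gap :: "'v \<Rightarrow> 'v \<Rightarrow> real" where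
  "minty_gap u y = blinfun_apply (S y) (y - u) + p y - p u"

lemma stampacchia_le_minty: "stampacchia_gap u y \<le> minty_gap u y"
  using S_mono[unfolded monotone_op_def, rule_format, of y u]
  by (simp add: stampacchia_gap_def minty_gap_def blinfun.diff_left)

lemma weak_limit_in_C: "(\<And>n. us n \<in> C) \<Longrightarrow> weak_conv us u \<Longrightarrow> u \<in> C"
  by (rule weak_conv_closed_convex[OF C(2,3)])

lemma p_sublevel: "closed {x \<in> C. p x \<le> c}" "convex {x \<in> C. p x \<le> c}"
proof -
  have "closed (C \<inter> p -` {..c})" by (rule continuous_closed_preimage[OF p_cont C(2)]) simp
  moreover have "C \<inter> p -` {..c} = {x \<in> C. p x \<le> c}" by auto
  ultimately show "closed {x \<in> C. p x \<le> c}" by simp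
  show "convex {x \<in> C. p x \<le> c}"
  proof (rule convexI)
    fix x y and a b :: real
    assume x: "x \<in> {x \<in> C. p x \<le> c}" and y: "y \<in> {x \<in> C. p x \<le> c}" and ab: "0 \<le> a" "0 \<le> b" "a + b = 1"
    have "p (a *\<^sub>R x + b *\<^sub>R y) \<le> a * p x + b * p y"
      using p_convex x y ab by (auto simp: convex_on_def)
    also have "\<dots> \<le> a * c + b * c" using x y ab by (intro add_mono mult_left_mono) auto
    also have "\<dots> = c" using ab by (simp flip: distrib_right)
    finally show "a *\<^sub>R x + b *\<^sub>R y \<in> {x \<in> C. p x \<le> c}" using x y ab C(3) by (auto simp: convexD)
  qed
qed

text \<open>A subsequence violating the bound would stay in a closed convex sublevel set, and so
  would its weak limit \<open>u\<close>.\<close>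

lemma p_weakly_lsc:
  assumes us: "\<And>n. us n \<in> C" "weak_conv us u" and e: "e > 0"
  shows "\<forall>\<^sub>F n in sequentially. p u - e < p (us n)"
proof (rule ccontr)
  assume "\<not> ?thesis"
  then obtain r :: "nat \<Rightarrow> nat" where r: "strict_mono r" "\<And>n. \<not> p u - e < p (us (r n))"
    using not_eventually_sequentiallyD by blast
  have "weak_conv (\<lambda>n. us (r n)) u"
    unfolding weak_conv_def
    using us(2) LIMSEQ_subseq_LIMSEQ[OF _ r(1)] unfolding weak_conv_def o_def by blast
  then have "u \<in> {x \<in> C. p x \<le> p u - e}"
    by (rule weak_conv_closed_convex[OF p_sublevel, rotated]) (use us(1) r(2) in \<open>simp add: not_less\<close>)
  then show False using e by simp
qed

text \<open>\<open>p (us n)\<close> may fail to converge, but it enters negatively with a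
  nonnegative weight, so \<open>p u - e\<close> may replace it before \<open>e\<close> tends to 0.
  The weights \<open>b\<close> and the term \<open>d\<close> are there for the bifunction in
  \<open>solution_exists\<close>.\<close>

lemma weak_limit_inequality:
  fixes b c d :: "nat \<Rightarrow> real"
  assumes us: "\<And>n. us n \<in> C" "weak_conv us u"
    and b: "\<And>n. b n \<ge> 0" and lim: "b \<longlonglongrightarrow> b'" "c \<longlonglongrightarrow> c'" "d \<longlonglongrightarrow> d'"
    and ge: "\<And>n. b n * (c n - p (us n)) + d n \<ge> 0"
  shows "b' * (c' - p u) + d' \<ge> 0"
proof -
  have eps: "b' * (c' - (p u - e)) + d' \<ge> 0" if "e > 0" for e
  proof (rule tendsto_lowerbound)
    show "(\<lambda>n. b n * (c n - (p u - e)) + d n) \<longlonglongrightarrow> b' * (c' - (p u - e)) + d'"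
      by (intro tendsto_intros lim)
    show "\<forall>\<^sub>F n in sequentially. 0 \<le> b n * (c n - (p u - e)) + d n"
      using p_weakly_lsc[OF us that]
    proof eventually_elim
      case (elim n)
      then have "b n * (c n - p (us n)) \<le> b n * (c n - (p u - e))"
        using b[of n] by (intro mult_left_mono) auto
      then show ?case using ge[of n] by linarith
    qed
  qed simp
  have "((\<lambda>e. b' * (c' - (p u - e)) + d') \<longlongrightarrow> b' * (c' - (p u - 0)) + d') (at_right 0)"
    by (intro tendsto_intros)
  then have "b' * (c' - (p u - 0)) + d' \<ge> 0"
    by (rule tendsto_lowerbound) (auto simp: eventually_at_right_field intro!: exI[of _ 1] eps)
  then show ?thesis by simp
qed

text \<open>An open set \<open>U\<close> of test points is allowed because truncated constraint sets are needed in the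
  existence proof.\<close>

lemma minty_weakly_closed:
  assumes us: "\<And>n. us n \<in> C" "weak_conv us u" "\<And>n. norm (us n) \<le> R"
    and U: "open U"
    and ge: "\<And>n y. y \<in> K (us n) \<Longrightarrow> y \<in> U \<Longrightarrow> minty_gap (us n) y \<ge> 0"
    and y: "y \<in> K u" "y \<in> U"
  shows "minty_gap u y \<ge> 0"
proof -
  have uC: "u \<in> C" by (rule weak_limit_in_C[OF us(1,2)])
  have yC: "y \<in> C" using K_sub uC y(1) by blast
  obtain ys where ys: "\<And>n. ys n \<in> C" "\<And>n. ys n \<in> K (us n)" "ys \<longlonglongrightarrow> y"
    using K_lower[of us u y] us(1,2) uC y(1) by blast
  obtain N where N: "\<And>n. n \<ge> N \<Longrightarrow> ys n \<in> U"
    using topological_tendstoD[OF ys(3) U y(2)] by (auto simp: eventually_sequentially)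
  have Sy: "(\<lambda>n. S (ys n)) \<longlonglongrightarrow> S y"
    using S_cont ys(3) by (rule continuous_on_tendsto_compose) auto
  \<comment> \<open>\<open>S (ys n)\<close> converges in norm and \<open>us\<close> only weakly;
    boundedness of \<open>us\<close> makes the error in the pairing vanish.\<close>
  have "(\<lambda>n. blinfun_apply (S (ys n) - S y) (us n)) \<longlonglongrightarrow> 0"
  proof (rule Lim_null_comparison)
    show "\<forall>\<^sub>F n in sequentially. norm (blinfun_apply (S (ys n) - S y) (us n)) \<le> norm (S (ys n) - S y) * R"
      by (intro always_eventually allI order_trans[OF norm_blinfun] mult_left_mono us(3)) simp
    have "(\<lambda>n. norm (S (ys n) - S y)) \<longlonglongrightarrow> 0" using Sy by (simp add: LIM_zero tendsto_norm_zero)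
    then show "(\<lambda>n. norm (S (ys n) - S y) * R) \<longlonglongrightarrow> 0" by (rule tendsto_mult_left_zero)
  qed
  moreover have "(\<lambda>n. blinfun_apply (S y) (us n)) \<longlonglongrightarrow> blinfun_apply (S y) u"
    using us(2) by (simp add: weak_conv_def)
  ultimately have "(\<lambda>n. blinfun_apply (S (ys n) - S y) (us n) + blinfun_apply (S y) (us n))
      \<longlonglongrightarrow> 0 + blinfun_apply (S y) u"
    by (rule tendsto_add)
  then have "(\<lambda>n. blinfun_apply (S (ys n)) (us n)) \<longlonglongrightarrow> blinfun_apply (S y) u"
    by (simp add: blinfun.diff_left)
  moreover have "(\<lambda>n. blinfun_apply (S (ys n)) (ys n)) \<longlonglongrightarrow> blinfun_apply (S y) y"
    by (intro blinfun.tendsto Sy ys)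
  moreover have "(\<lambda>n. p (ys n)) \<longlonglongrightarrow> p y"
    by (rule continuous_on_tendsto_compose[OF p_cont ys(3) yC]) (simp add: ys(1))
  ultimately have "(\<lambda>n. blinfun_apply (S (ys n)) (ys n) - blinfun_apply (S (ys n)) (us n) + p (ys n))
      \<longlonglongrightarrow> blinfun_apply (S y) y - blinfun_apply (S y) u + p y"
    by (intro tendsto_add tendsto_diff)
  then have lim: "(\<lambda>n. blinfun_apply (S (ys n)) (ys n - us n) + p (ys n))
      \<longlonglongrightarrow> blinfun_apply (S y) (y - u) + p y"
    by (simp add: blinfun.diff_right)
  have "1 * ((blinfun_apply (S y) (y - u) + p y) - p u) + 0 \<ge> 0"
  proof (rule weak_limit_inequality[where us = "\<lambda>n. us (n + N)" and b = "\<lambda>_. 1" and d = "\<lambda>_. 0"])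
    show "weak_conv (\<lambda>n. us (n + N)) u"
      using us(2) unfolding weak_conv_def by (auto intro: LIMSEQ_ignore_initial_segment)
    show "(\<lambda>n. blinfun_apply (S (ys (n + N))) (ys (n + N) - us (n + N)) + p (ys (n + N)))
      \<longlonglongrightarrow> blinfun_apply (S y) (y - u) + p y"
      using lim by (rule LIMSEQ_ignore_initial_segment)
    show "0 \<le> 1 * (blinfun_apply (S (ys (n + N))) (ys (n + N) - us (n + N)) + p (ys (n + N))
        - p (us (n + N))) + 0" for n
      using ge[OF ys(2) N, of "n + N"] by (simp add: minty_gap_def)
  qed (auto simp: us(1))
  then show ?thesis by (simp add: minty_gap_def)
qed

text \<open>Convexity of \<open>p\<close> bounds the gap on the segment by \<open>t\<close> times an
  expression with \<open>S\<close> evaluated near \<open>u\<close>; dividing by \<open>t\<close>,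
  let \<open>t\<close> tend to 0. Testing on the segment alone suits truncated constraint
  sets.\<close>

lemma minty:
  assumes u: "u \<in> C" and y: "y \<in> C"
    and ge: "\<And>t. 0 < t \<Longrightarrow> t \<le> 1 \<Longrightarrow> minty_gap u (u + t *\<^sub>R (y - u)) \<ge> 0"
  shows "stampacchia_gap u y \<ge> 0"
proof -
  have ge': "blinfun_apply (S (u + t *\<^sub>R (y - u))) (y - u) + p y - p u \<ge> 0" if t: "0 < t" "t \<le> 1" for t
  proof -
    have eq: "u + t *\<^sub>R (y - u) = (1 - t) *\<^sub>R u + t *\<^sub>R y" by (simp add: algebra_simps)
    have "p (u + t *\<^sub>R (y - u)) \<le> (1 - t) * p u + t * p y"
      unfolding eq using t u y by (intro convex_onD[OF p_convex]) auto
    moreover have "minty_gap u (u + t *\<^sub>R (y - u)) =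
        t * blinfun_apply (S (u + t *\<^sub>R (y - u))) (y - u) + p (u + t *\<^sub>R (y - u)) - p u"
      by (simp add: minty_gap_def blinfun.scaleR_right)
    ultimately have "t * (blinfun_apply (S (u + t *\<^sub>R (y - u))) (y - u) + p y - p u) \<ge> 0"
      using ge[OF t] by (simp add: algebra_simps)
    then show ?thesis using t by (simp add: zero_le_mult_iff)
  qed
  have "((\<lambda>t. S (u + t *\<^sub>R (y - u))) \<longlongrightarrow> S (u + 0 *\<^sub>R (y - u))) (at_right 0)"
    by (rule continuous_on_tendsto_compose[OF S_cont]) (auto intro!: tendsto_eq_intros)
  then have "((\<lambda>t. blinfun_apply (S (u + t *\<^sub>R (y - u))) (y - u) + p y - p u) \<longlongrightarrow>
      blinfun_apply (S (u + 0 *\<^sub>R (y - u))) (y - u) + p y - p u) (at_right 0)"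
    by (intro tendsto_intros)
  then have "blinfun_apply (S (u + 0 *\<^sub>R (y - u))) (y - u) + p y - p u \<ge> 0"
    by (rule tendsto_lowerbound)
      (use ge' in \<open>force simp: eventually_at_right_field intro: exI[of _ 1]\<close>)+
  then show ?thesis by (simp add: stampacchia_gap_def)
qed

theorem solution_exists:
  assumes C0: "C0 \<subseteq> cball 0 R" "\<And>u. u \<in> C \<Longrightarrow> K u \<inter> C0 \<noteq> {}"
    and apriori: "\<And>u v. u \<in> C \<Longrightarrow> v \<in> K u \<inter> C0 \<Longrightarrow> stampacchia_gap u v \<ge> 0 \<Longrightarrow> norm u \<le> R"
  obtains u where "u \<in> C" "u \<in> K u" "\<And>v. v \<in> K u \<Longrightarrow> stampacchia_gap u v \<ge> 0"
proof -
  \<comment> \<open>The margin 1 puts points of norm at most \<open>R\<close> in the interior of the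
    ball, so the truncation can be undone at the end.\<close>
  define W where "W = C \<inter> cball 0 (R + 1)"
  have KC: "y \<in> C" if "u \<in> C" "y \<in> K u" for u y using K_sub that by blast
  have KW: "y \<in> W" if "u \<in> C" "y \<in> K u \<inter> C0" for u y
    using KC[OF that(1)] C0(1) that(2) by (force simp: W_def)
  obtain u0 v0 where "u0 \<in> C" "v0 \<in> K u0 \<inter> C0" using C(1) C0(2) by blast
  then have "v0 \<in> W" by (rule KW)
  have "bounded W" by (rule bounded_subset[OF bounded_cball, of _ 0 "R + 1"]) (simp add: W_def)
  then have W: "convex W" "closed W" "bounded W" "W \<noteq> {}"
    using C \<open>v0 \<in> W\<close> unfolding W_def by (auto intro!: convex_Int closed_Int)
  have WR: "norm w \<le> R + 1" if "w \<in> W" for w using that by (simp add: W_def)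
  have WC: "w \<in> C" if "w \<in> W" for w using that by (simp add: W_def)
  have W_lim: "x \<in> W" if "\<And>n. xs n \<in> W" "weak_conv xs x" for xs x
    using W(2,1) that by (rule weak_conv_closed_convex)
  \<comment> \<open>The strict bound on \<open>norm y\<close> gives an open set of test points, as
    \<open>minty_weakly_closed\<close> demands.\<close>
  define Q0 where "Q0 = {u \<in> W. \<forall>y\<in>K u. norm y < R + 1 \<longrightarrow> minty_gap u y \<ge> 0}"
  \<comment> \<open>A point \<open>u\<close> of \<open>W\<close> lies outside \<open>Q1 f\<close>
    iff \<open>f\<close> is larger at \<open>u\<close> than everywhere on
    \<open>K u \<inter> W\<close>.\<close>
  define Q1 where "Q1 f = {u \<in> W. \<exists>y\<in>K u \<inter> W. blinfun_apply f (u - y) \<le> 0}"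
    for f :: "'v \<Rightarrow>\<^sub>L real"
  have Q0_closed: "weakly_closed Q0"
  proof (rule weakly_closed_if_sequentially[OF refl])
    show "bounded Q0" using W(3) by (rule bounded_subset) (auto simp: Q0_def)
    show "x \<in> Q0" if xs: "\<And>n. xs n \<in> Q0" "weak_conv xs x" for xs x
    proof -
      have xsW: "xs n \<in> W" for n using xs(1) by (simp add: Q0_def)
      have "minty_gap x y \<ge> 0" if "y \<in> K x" "y \<in> ball 0 (R + 1)" for y
        by (rule minty_weakly_closed[OF WC[OF xsW] xs(2) WR[OF xsW] open_ball _ that])
          (use xs(1) in \<open>auto simp: Q0_def\<close>)
      then show ?thesis using W_lim[OF xsW xs(2)] by (simp add: Q0_def)
    qed
  qed
  have Q1_closed: "weakly_closed (Q1 f)" for f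
  proof (rule weakly_closed_if_sequentially[OF refl])
    show "bounded (Q1 f)" using W(3) by (rule bounded_subset) (auto simp: Q1_def)
    show "x \<in> Q1 f" if xs: "\<And>n. xs n \<in> Q1 f" "weak_conv xs x" for xs x
    proof -
      have xsW: "xs n \<in> W" for n using xs(1) by (simp add: Q1_def)
      have "\<forall>n. \<exists>y. y \<in> K (xs n) \<and> y \<in> W \<and> blinfun_apply f (xs n - y) \<le> 0"
        using xs(1) by (auto simp: Q1_def)
      then obtain ys where ys: "\<And>n. ys n \<in> K (xs n)" "\<And>n. ys n \<in> W"
          "\<And>n. blinfun_apply f (xs n - ys n) \<le> 0"
        by metis
      \<comment> \<open>\<open>ys\<close> is only known to be bounded; a weakly convergent
        reindexing, applied to \<open>xs\<close> as well, makes \<open>K_upper\<close>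
        applicable.\<close>
      obtain k y where k: "filterlim k at_top sequentially" "weak_conv (\<lambda>n. ys (k n)) y"
        by (rule bounded_weak_subsequence[OF refl WR[OF ys(2)]])
      have xk: "weak_conv (\<lambda>n. xs (k n)) x"
        unfolding weak_conv_def
      proof
        fix g :: "'v \<Rightarrow>\<^sub>L real"
        have "(\<lambda>n. blinfun_apply g (xs n)) \<longlonglongrightarrow> blinfun_apply g x"
          using xs(2) by (simp add: weak_conv_def)
        then show "(\<lambda>n. blinfun_apply g (xs (k n))) \<longlonglongrightarrow> blinfun_apply g x"
          using k(1) by (rule filterlim_compose)
      qed
      have "y \<in> K x" by (rule K_upper[OF _ xk k(2)]) (use ys WC xsW in auto)
      moreover have "y \<in> W" by (rule W_lim[OF ys(2) k(2)])
      moreover have "blinfun_apply f (x - y) \<le> 0"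
      proof (rule LIMSEQ_le_const2)
        show "(\<lambda>n. blinfun_apply f (xs (k n) - ys (k n))) \<longlonglongrightarrow> blinfun_apply f (x - y)"
          using xk k(2) unfolding blinfun.diff_right weak_conv_def by (intro tendsto_diff) auto
      qed (use ys(3) in blast)
      ultimately show ?thesis using W_lim[OF xsW xs(2)] by (auto simp: Q1_def)
    qed
  qed
  have "\<exists>u\<in>Q0. u \<in> K u"
  proof (rule ccontr)
    assume none: "\<not> (\<exists>u\<in>Q0. u \<in> K u)"
    have "\<exists>f. w \<notin> Q0 \<or> w \<notin> Q1 f" if w: "w \<in> W" for w
    proof (cases "w \<in> Q0")
      case True
      define D where "D = K w \<inter> W"
      have D: "convex D" "closed D" "D \<noteq> {}" "w \<notin> D"
        using K_sub[OF WC[OF w]] W C0(2)[OF WC[OF w]] KW[OF WC[OF w]] none True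
        unfolding D_def by (blast intro: convex_Int closed_Int)+
      obtain f :: "'v \<Rightarrow>\<^sub>L real" where
          f: "\<And>s. s \<in> D \<Longrightarrow> blinfun_apply f w - blinfun_apply f s \<ge> infdist w D"
        by (rule separation_infdist[OF D(1,3), of w]) (rule that)
      have "infdist w D > 0" using D by (intro infdist_pos_not_in_closed)
      then have "blinfun_apply f (w - s) > 0" if "s \<in> D" for s
        using f[OF that] by (simp add: blinfun.diff_right)
      then have "w \<notin> Q1 f" unfolding Q1_def D_def by (auto simp: not_le[symmetric])
      then show ?thesis by blast
    qed auto
    then obtain f where f: "\<And>w. w \<in> W \<Longrightarrow> w \<in> Q0 \<Longrightarrow> w \<notin> Q1 (f w)" by metis
    define A where "A w = (if w \<in> Q0 then Q1 (f w) else Q0)" for w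
    have "weakly_closed (A w) \<and> w \<notin> A w" if "w \<in> W" for w
      using that f Q0_closed Q1_closed by (auto simp: A_def)
    then obtain Y F and e :: "'v \<Rightarrow> real" where Y: "finite Y" "Y \<subseteq> W"
      and F: "\<And>w. w \<in> W \<Longrightarrow> finite (F w)"
      and excl: "\<And>w z. w \<in> W \<Longrightarrow>
        \<forall>g\<in>F w. \<bar>blinfun_apply g z - blinfun_apply g w\<bar> < e w \<Longrightarrow> z \<notin> A w"
      and cov: "\<And>z. z \<in> W \<Longrightarrow> \<exists>w\<in>Y. \<forall>g\<in>F w. \<bar>blinfun_apply g z - blinfun_apply g w\<bar> < e w"
      using weak_compactness_weakly_closed[OF refl weakly_closed_closed_convex[OF refl W(1-3)] W(3), of A]
      by blast
    \<comment> \<open>Positive exactly on the neighbourhood of \<open>w\<close>, and dependent on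
      finitely many functionals, hence weakly continuous. Only signs will count, so the bumps are
      left unnormalised.\<close>
    define \<beta> where "\<beta> w u = (\<Prod>g\<in>F w. max 0 (e w - \<bar>blinfun_apply g u - blinfun_apply g w\<bar>))" for w u
    \<comment> \<open>Centres outside \<open>Q0\<close>, whose neighbourhoods miss
      \<open>Q0\<close>, make up the weight \<open>b\<close> of the Minty gap; centres
      \<open>w \<in> Q0\<close>, whose neighbourhoods miss \<open>Q1 (f w)\<close>, contribute
      \<open>f w\<close> to \<open>\<Phi>\<close>.\<close>
    define b where "b u = (\<Sum>w\<in>Y. \<beta> w u * (if w \<in> Q0 then 0 else 1))" for u
    define \<Phi> where "\<Phi> u = (\<Sum>w\<in>Y. \<beta> w u *\<^sub>R (if w \<in> Q0 then f w else 0))" for u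
    define G where "G y u = - (b u * minty_gap u y + blinfun_apply (\<Phi> u) (y - u))" for y u
    have \<beta>0: "\<beta> w u \<ge> 0" for w u unfolding \<beta>_def by (intro prod_nonneg) auto
    have \<beta>_pos: "\<beta> w u > 0 \<longleftrightarrow> (\<forall>g\<in>F w. \<bar>blinfun_apply g u - blinfun_apply g w\<bar> < e w)"
      if "w \<in> Y" for w u
    proof -
      have "finite (F w)" using F Y(2) that by blast
      then have "\<beta> w u \<noteq> 0 \<longleftrightarrow> (\<forall>g\<in>F w. \<bar>blinfun_apply g u - blinfun_apply g w\<bar> < e w)"
        by (auto simp: \<beta>_def max_def not_le)
      then show ?thesis using \<beta>0[of w u] by linarith
    qed
    have b0: "b u \<ge> 0" for u unfolding b_def using \<beta>0 by (intro sum_nonneg) auto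
    have \<Phi>: "blinfun_apply (\<Phi> u) z = (\<Sum>w\<in>Y. \<beta> w u * (if w \<in> Q0 then blinfun_apply (f w) z else 0))" for u z
      unfolding \<Phi>_def blinfun.sum_left by (intro sum.cong) (auto simp: blinfun.scaleR_left)
    obtain u where u: "u \<in> W" "\<And>y. y \<in> W \<Longrightarrow> G y u \<le> 0"
    proof (rule ky_fan_weak[OF refl W])
      show "continuous_on W (G y)" if "y \<in> W" for y
      proof -
        have "continuous_on W p" by (rule continuous_on_subset[OF p_cont]) (auto simp: W_def)
        moreover have "continuous_on W (\<lambda>x. if w \<in> Q0 then blinfun_apply (f w) (y - x) else 0)" for w
          by (cases "w \<in> Q0") (auto intro!: continuous_intros)
        ultimately show ?thesis
          unfolding G_def b_def \<Phi> minty_gap_def \<beta>_def by (intro continuous_intros)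
      qed
      show "G y x \<le> 0" if y: "y \<in> W" and us: "\<And>n. us n \<in> W" "weak_conv us x" "\<And>n. G y (us n) \<le> 0"
        for y us x
      proof -
        have lim: "(\<lambda>n. blinfun_apply g (us n)) \<longlonglongrightarrow> blinfun_apply g x" for g :: "'v \<Rightarrow>\<^sub>L real"
          using us(2) by (simp add: weak_conv_def)
        have lim\<beta>: "(\<lambda>n. \<beta> w (us n)) \<longlonglongrightarrow> \<beta> w x" for w
          unfolding \<beta>_def by (intro tendsto_prod tendsto_max tendsto_diff tendsto_rabs tendsto_const lim)
        have limd: "(\<lambda>n. blinfun_apply g (y - us n)) \<longlonglongrightarrow> blinfun_apply g (y - x)" for g :: "'v \<Rightarrow>\<^sub>L real"
          unfolding blinfun.diff_right by (intro tendsto_diff tendsto_const lim)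
        have "b x * ((blinfun_apply (S y) (y - x) + p y) - p x) + blinfun_apply (\<Phi> x) (y - x) \<ge> 0"
        proof (rule weak_limit_inequality[OF WC[OF us(1)] us(2)])
          show "b (us n) \<ge> 0" for n by (rule b0)
          show "(\<lambda>n. b (us n)) \<longlonglongrightarrow> b x"
            unfolding b_def by (intro tendsto_sum tendsto_mult tendsto_const lim\<beta>)
          show "(\<lambda>n. blinfun_apply (S y) (y - us n) + p y) \<longlonglongrightarrow> blinfun_apply (S y) (y - x) + p y"
            by (intro tendsto_add tendsto_const limd)
          have "(\<lambda>n. if w \<in> Q0 then blinfun_apply (f w) (y - us n) else 0)
              \<longlonglongrightarrow> (if w \<in> Q0 then blinfun_apply (f w) (y - x) else 0)" for w
            using limd by auto
          then show "(\<lambda>n. blinfun_apply (\<Phi> (us n)) (y - us n)) \<longlonglongrightarrow> blinfun_apply (\<Phi> x) (y - x)"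
            unfolding \<Phi> by (intro tendsto_sum tendsto_mult lim\<beta>)
          show "0 \<le> b (us n) * (blinfun_apply (S y) (y - us n) + p y - p (us n))
              + blinfun_apply (\<Phi> (us n)) (y - us n)" for n
            using us(3)[of n] by (simp add: G_def minty_gap_def)
        qed
        then show ?thesis by (simp add: G_def minty_gap_def)
      qed
      show "(\<Sum>y\<in>Z. l y * G y (\<Sum>y\<in>Z. l y *\<^sub>R y)) \<le> 0"
        if Z: "finite Z" "Z \<subseteq> W" and l: "\<And>y. y \<in> Z \<Longrightarrow> l y \<ge> 0" "sum l Z = 1" for Z l
      proof -
        define x where "x = (\<Sum>y\<in>Z. l y *\<^sub>R y)"
        \<comment> \<open>Linear terms average to zero at the barycentre \<open>x\<close>, which
          disposes of \<open>\<Phi> x\<close> and \<open>S x\<close>. Jensen's inequality for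
          \<open>p\<close> and monotonicity do the rest.\<close>
        have lin: "(\<Sum>y\<in>Z. l y * blinfun_apply g (y - x)) = 0" for g :: "'v \<Rightarrow>\<^sub>L real"
        proof -
          have "(\<Sum>y\<in>Z. l y * blinfun_apply g (y - x)) = blinfun_apply g x - sum l Z * blinfun_apply g x"
            by (simp add: x_def blinfun.diff_right blinfun.sum_right blinfun.scaleR_right
                right_diff_distrib sum_subtractf sum_distrib_right)
          then show ?thesis using l(2) by simp
        qed
        have "Z \<noteq> {}" using l(2) by auto
        then have "p x \<le> (\<Sum>y\<in>Z. l y * p y)"
          unfolding x_def using Z l WC by (intro convex_on_sum[OF _ _ p_convex]) auto
        then have "0 \<le> (\<Sum>y\<in>Z. l y * blinfun_apply (S x) (y - x)) + (\<Sum>y\<in>Z. l y * p y) - sum l Z * p x"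
          using lin l(2) by simp
        also have "\<dots> = (\<Sum>y\<in>Z. l y * stampacchia_gap x y)"
          by (simp add: stampacchia_gap_def algebra_simps sum.distrib sum_subtractf sum_distrib_left)
        also have "\<dots> \<le> (\<Sum>y\<in>Z. l y * minty_gap x y)"
          using l(1) stampacchia_le_minty by (intro sum_mono mult_left_mono) auto
        finally have "0 \<le> b x * (\<Sum>y\<in>Z. l y * minty_gap x y) + (\<Sum>y\<in>Z. l y * blinfun_apply (\<Phi> x) (y - x))"
          using b0[of x] lin by simp
        also have "\<dots> = - (\<Sum>y\<in>Z. l y * G y x)"
          by (simp add: G_def sum_distrib_left algebra_simps sum.distrib sum_negf sum_subtractf)
        finally show ?thesis by (simp add: x_def)
      qed
    qed blast
    have uC: "u \<in> C" by (rule WC[OF u(1)])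
    have f_pos: "blinfun_apply (f w) (u - y) > 0"
      if "w \<in> Y" "w \<in> Q0" "\<beta> w u > 0" "y \<in> K u \<inter> W" for w y
    proof -
      have "u \<notin> Q1 (f w)" using excl[of w u] \<beta>_pos that Y(2) by (auto simp: A_def)
      then show ?thesis using that(4) u(1) by (auto simp: Q1_def not_le)
    qed
    have \<Phi>_le: "\<beta> w u * (if w \<in> Q0 then blinfun_apply (f w) (y - u) else 0) \<le> 0"
      if "w \<in> Y" "y \<in> K u \<inter> W" for w y
    proof (cases "w \<in> Q0 \<and> \<beta> w u > 0")
      case True
      then have "blinfun_apply (f w) (y - u) < 0"
        using f_pos[of w y] that by (simp add: blinfun.diff_right)
      then show ?thesis using \<beta>0[of w u] by (simp add: mult_nonneg_nonpos)
    next
      case False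
      then show ?thesis using \<beta>0[of w u] by (auto simp: not_less)
    qed
    \<comment> \<open>If \<open>b u > 0\<close>, some active centre lies outside \<open>Q0\<close>,
      so a test point has a negative Minty gap. If \<open>b u = 0\<close>, an active centre lies in
      \<open>Q0\<close>, and its functional is strictly smaller on \<open>K u \<inter> W\<close>
      than at \<open>u\<close>. No other term has the opposite sign, so \<open>G y u > 0\<close> for
      some \<open>y\<close>.\<close>
    show False
    proof (cases "b u > 0")
      case True
      have "\<exists>w\<in>Y. w \<notin> Q0 \<and> \<beta> w u > 0"
      proof (rule ccontr)
        assume none: "\<not> ?thesis"
        have "\<beta> w u * (if w \<in> Q0 then 0 else 1) = 0" if "w \<in> Y" for w
          using that none \<beta>0[of w u] by (cases "w \<in> Q0") auto
        then have "b u = 0" unfolding b_def by (intro sum.neutral) blast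
        then show False using True by simp
      qed
      then obtain w where w: "w \<in> Y" "w \<notin> Q0" "\<beta> w u > 0" by blast
      then have "u \<notin> Q0" using excl[of w u] \<beta>_pos[of w u] Y(2) by (auto simp: A_def)
      then obtain y where y: "y \<in> K u" "norm y < R + 1" "minty_gap u y < 0"
        using u(1) by (auto simp: Q0_def not_le)
      have yW: "y \<in> W" using y KC[OF uC] by (simp add: W_def)
      have "blinfun_apply (\<Phi> u) (y - u) \<le> 0"
        unfolding \<Phi> using \<Phi>_le y(1) yW by (intro sum_nonpos) auto
      moreover have "b u * minty_gap u y < 0" using True y(3) by (rule mult_pos_neg)
      ultimately show False using u(2)[OF yW] by (simp add: G_def)
    next
      case False
      then have b: "b u = 0" using b0[of u] by simp
      obtain w where w: "w \<in> Y" "\<beta> w u > 0" using cov[OF u(1)] \<beta>_pos by blast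
      have "\<beta> w u * (if w \<in> Q0 then 0 else 1) \<le> b u"
        unfolding b_def using w(1) Y(1) \<beta>0 by (intro member_le_sum) auto
      then have wQ: "w \<in> Q0" using b w(2) by (auto split: if_splits)
      obtain y where "y \<in> K u \<inter> C0" using C0(2)[OF uC] by blast
      then have y: "y \<in> K u \<inter> W" using KW[OF uC] by blast
      have "blinfun_apply (\<Phi> u) (y - u) < (\<Sum>w\<in>Y. 0)"
        unfolding \<Phi>
      proof (rule sum_strict_mono_ex1[OF Y(1)])
        show "\<exists>w\<in>Y. \<beta> w u * (if w \<in> Q0 then blinfun_apply (f w) (y - u) else 0) < 0"
          using w wQ f_pos[OF w(1) wQ w(2) y]
          by (intro bexI[of _ w]) (auto simp: blinfun.diff_right mult_pos_neg)
      qed (use \<Phi>_le y in auto)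
      then show False using u(2)[of y] y b by (simp add: G_def)
    qed
  qed
  then obtain u where u: "u \<in> W" "u \<in> K u" "\<And>y. y \<in> K u \<Longrightarrow> norm y < R + 1 \<Longrightarrow> minty_gap u y \<ge> 0"
    by (auto simp: Q0_def)
  have uC: "u \<in> C" and uR: "norm u \<le> R + 1" using u(1) by (auto simp: W_def)
  have seg: "u + t *\<^sub>R (y - u) \<in> K u" if "y \<in> K u" "0 < t" "t \<le> 1" for t y
  proof -
    have "(1 - t) *\<^sub>R u + t *\<^sub>R y \<in> K u" using K_sub[OF uC] u(2) that by (intro convexD) auto
    then show ?thesis by (simp add: algebra_simps)
  qed
  have local: "stampacchia_gap u y \<ge> 0" if y: "y \<in> K u" "norm y < R + 1" for y
  proof (rule minty[OF uC KC[OF uC y(1)]])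
    fix t :: real assume t: "0 < t" "t \<le> 1"
    have "norm (u + t *\<^sub>R (y - u)) = norm ((1 - t) *\<^sub>R u + t *\<^sub>R y)" by (simp add: algebra_simps)
    also have "\<dots> \<le> (1 - t) * norm u + t * norm y"
      using norm_triangle_ineq[of "(1 - t) *\<^sub>R u" "t *\<^sub>R y"] t by simp
    also have "\<dots> < (1 - t) * (R + 1) + t * (R + 1)"
      using t uR y(2) by (intro add_le_less_mono mult_left_mono mult_strict_left_mono) auto
    also have "\<dots> = R + 1" by (simp add: algebra_simps)
    finally show "minty_gap u (u + t *\<^sub>R (y - u)) \<ge> 0" using u(3) seg[OF y(1) t] by blast
  qed
  \<comment> \<open>\<open>v0\<close> passes the truncation since \<open>norm v0 \<le> R\<close>;
    the a priori bound then moves \<open>u\<close> off the boundary of the ball.\<close>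
  obtain v0 where v0: "v0 \<in> K u \<inter> C0" using C0(2)[OF uC] by blast
  then have "norm v0 \<le> R" using C0(1) by auto
  then have "norm u \<le> R" using apriori[OF uC v0] local[of v0] v0 by auto
  show ?thesis
  proof (rule that[OF uC u(2)])
    fix v assume v: "v \<in> K u"
    \<comment> \<open>A step shorter than 1 from \<open>u\<close> stays in the open ball of radius
      \<open>R + 1\<close>; convexity of \<open>p\<close> scales the inequality back up to
      \<open>v\<close>.\<close>
    define t where "t = 1 / (1 + norm (v - u))"
    have "1 + norm (v - u) > 0" by (simp add: add_pos_nonneg)
    then have t: "0 < t" "t \<le> 1" "t * norm (v - u) < 1" by (auto simp: t_def)
    have "norm (u + t *\<^sub>R (v - u)) < R + 1"
      using norm_triangle_ineq[of u "t *\<^sub>R (v - u)"] t \<open>norm u \<le> R\<close> by simp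
    then have "0 \<le> stampacchia_gap u (u + t *\<^sub>R (v - u))" using local seg[OF v t(1,2)] by blast
    also have "\<dots> \<le> t * stampacchia_gap u v"
    proof -
      have eq: "u + t *\<^sub>R (v - u) = (1 - t) *\<^sub>R u + t *\<^sub>R v" by (simp add: algebra_simps)
      have "p (u + t *\<^sub>R (v - u)) \<le> (1 - t) * p u + t * p v"
        unfolding eq using t uC KC[OF uC v] by (intro convex_onD[OF p_convex]) auto
      moreover have "stampacchia_gap u (u + t *\<^sub>R (v - u))
          = t * blinfun_apply (S u) (v - u) + p (u + t *\<^sub>R (v - u)) - p u"
        by (simp add: stampacchia_gap_def blinfun.scaleR_right)
      ultimately show ?thesis
        by (simp add: stampacchia_gap_def left_diff_distrib right_diff_distrib distrib_left)
    qed
    finally show "stampacchia_gap u v \<ge> 0" using t(1) by (simp add: zero_le_mult_iff)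
  qed
qed

end

subsection \<open>Extended-real-valued convex functions\<close>

lemma Baire_closed_cover:
  fixes T :: "nat \<Rightarrow> 'a::complete_space set"
  assumes "\<And>n. closed (T n)" "interior (\<Union>n. T n) \<noteq> {}"
  obtains n where "interior (T n) \<noteq> {}"
proof (rule ccontr)
  assume "\<not> thesis"
  then have "\<And>n. interior (T n) = {}" using that by blast
  then have "Met_TC.mtopology interior_of \<Union> (range T) = {}"
    using assms(1) complete_UNIV by (intro Met_TC.metric_Baire_category_alt) auto
  then show False using assms(2) by simp
qed

lemma proper_fun_real:
  assumes "proper_fun \<phi>" "x \<in> dom_fun \<phi>"
  shows "\<phi> x = ereal (real_of_ereal (\<phi> x))"
  using assms by (cases "\<phi> x") (auto simp: proper_fun_def dom_fun_def)

context
  fixes \<phi> :: "'v::banach \<Rightarrow> ereal"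
  assumes proper: "proper_fun \<phi>" and convex: "convex_fun \<phi>"
begin

lemma convex_fun_real:
  assumes x: "x \<in> dom_fun \<phi>" and y: "y \<in> dom_fun \<phi>" and t: "0 \<le> t" "t \<le> 1"
  shows "(1 - t) *\<^sub>R x + t *\<^sub>R y \<in> dom_fun \<phi>"
    and "real_of_ereal (\<phi> ((1 - t) *\<^sub>R x + t *\<^sub>R y))
      \<le> (1 - t) * real_of_ereal (\<phi> x) + t * real_of_ereal (\<phi> y)"
proof -
  have "\<phi> ((1 - t) *\<^sub>R x + t *\<^sub>R y) \<le> ereal (1 - t) * \<phi> x + ereal t * \<phi> y"
    using convex t by (simp add: convex_fun_def)
  also have "\<dots> = ereal ((1 - t) * real_of_ereal (\<phi> x) + t * real_of_ereal (\<phi> y))"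
    by (subst proper_fun_real[OF proper x], subst proper_fun_real[OF proper y]) simp
  finally have le: "\<phi> ((1 - t) *\<^sub>R x + t *\<^sub>R y)
      \<le> ereal ((1 - t) * real_of_ereal (\<phi> x) + t * real_of_ereal (\<phi> y))" .
  then show dom: "(1 - t) *\<^sub>R x + t *\<^sub>R y \<in> dom_fun \<phi>"
    unfolding dom_fun_def by (auto elim: order.strict_trans1)
  show "real_of_ereal (\<phi> ((1 - t) *\<^sub>R x + t *\<^sub>R y))
      \<le> (1 - t) * real_of_ereal (\<phi> x) + t * real_of_ereal (\<phi> y)"
    using le by (subst (asm) proper_fun_real[OF proper dom]) simp
qed

lemma convex_on_real_of_ereal:
  assumes "A \<subseteq> dom_fun \<phi>" "convex A"
  shows "convex_on A (\<lambda>x. real_of_ereal (\<phi> x))"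
proof (rule convex_onI)
  fix t :: real and x y assume "0 < t" "t < 1" "x \<in> A" "y \<in> A"
  then show "real_of_ereal (\<phi> ((1 - t) *\<^sub>R x + t *\<^sub>R y))
      \<le> (1 - t) * real_of_ereal (\<phi> x) + t * real_of_ereal (\<phi> y)"
    using assms(1) by (intro convex_fun_real) auto
qed (rule assms)

text \<open>The closed sublevel sets cover a ball around \<open>x\<close>, so by Baire's theorem one
  of them contains a ball. Convexity carries this upper bound to a neighbourhood of
  \<open>x\<close>, and local boundedness makes a convex function continuous.\<close>

lemma continuous_on_interior_dom:
  assumes lsc: "lsc_fun \<phi>"
  shows "continuous_on (interior (dom_fun \<phi>)) (\<lambda>x. real_of_ereal (\<phi> x))"
proof (rule continuous_at_imp_continuous_on, rule ballI)
  let ?p = "\<lambda>x. real_of_ereal (\<phi> x)"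
  fix x assume "x \<in> interior (dom_fun \<phi>)"
  then obtain r where r: "r > 0" "cball x r \<subseteq> dom_fun \<phi>" unfolding mem_interior_cball by blast
  define T where "T n = {y. \<phi> y \<le> ereal (real n)} \<inter> cball x r" for n :: nat
  have "cball x r \<subseteq> (\<Union>n. T n)"
  proof
    fix y assume y: "y \<in> cball x r"
    then have eq: "\<phi> y = ereal (?p y)" using r(2) by (intro proper_fun_real[OF proper]) blast
    obtain n :: nat where "?p y \<le> real n" using real_arch_simple by blast
    then have "\<phi> y \<le> ereal (real n)" by (subst eq) simp
    then show "y \<in> (\<Union>n. T n)" using y by (auto simp: T_def)
  qed
  then have "ball x r \<subseteq> interior (\<Union>n. T n)"
    by (intro interior_maximal) auto
  then have "interior (\<Union>n. T n) \<noteq> {}" using r(1) by force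
  moreover have "closed (T n)" for n
    using lsc unfolding T_def lsc_fun_def by (intro closed_Int) auto
  ultimately obtain n where "interior (T n) \<noteq> {}" using Baire_closed_cover by blast
  then obtain z d where d: "d > 0" "ball z d \<subseteq> T n"
    unfolding mem_interior ex_in_conv[symmetric] by blast
  have z: "z \<in> cball x r" using d centre_in_ball[of z d] unfolding T_def by blast
  \<comment> \<open>The mirror image of \<open>z\<close> in \<open>x\<close>: each \<open>w\<close>
    near \<open>x\<close> is the midpoint of \<open>y\<close> and a point \<open>v\<close> near
    \<open>z\<close>.\<close>
  define y where "y = 2 *\<^sub>R x - z"
  have "x - y = z - x" by (simp add: y_def scaleR_2)
  then have y: "y \<in> dom_fun \<phi>" using z r(2) by (auto simp: dist_norm norm_minus_commute)
  \<comment> \<open>\<open>v - z\<close> is twice \<open>w - x\<close>, so the bound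
    \<open>d / 4\<close> keeps \<open>v\<close> within distance \<open>d\<close> of
    \<open>z\<close>.\<close>
  define e where "e = min r (d / 4)"
  have e: "e > 0" "cball x e \<subseteq> dom_fun \<phi>" using r d(1) by (auto simp: e_def)
  have conv: "convex_on (cball x e) ?p" by (rule convex_on_real_of_ereal[OF e(2)]) simp
  have upper: "?p w \<le> (real n + ?p y) / 2" if "w \<in> cball x e" for w
  proof -
    define v where "v = 2 *\<^sub>R w - y"
    have "z - v = 2 *\<^sub>R (x - w)" by (simp add: v_def y_def algebra_simps)
    then have "dist z v < d" using that d(1) by (simp add: dist_norm e_def)
    then have v: "v \<in> T n" using d(2) by auto
    then have vd: "v \<in> dom_fun \<phi>" using r(2) by (auto simp: T_def)
    have "\<phi> v \<le> ereal (real n)" using v by (simp add: T_def)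
    then have "?p v \<le> real n" by (subst (asm) proper_fun_real[OF proper vd]) simp
    moreover have "?p ((1 - 1/2) *\<^sub>R v + (1/2) *\<^sub>R y) \<le> (1 - 1/2) * ?p v + (1/2) * ?p y"
      by (rule convex_fun_real[OF vd y]) auto
    moreover have "(1 - 1/2) *\<^sub>R v + (1/2) *\<^sub>R y = w" by (simp add: v_def algebra_simps)
    ultimately show ?thesis by simp
  qed
  have "\<forall>w\<in>ball x e. \<bar>?p w\<bar> \<le> (real n + ?p y) / 2 + 2 * \<bar>?p x\<bar>"
    using convex_bounds_lemma[OF conv upper] mem_ball_imp_mem_cball by blast
  then have "continuous_on (ball x e) ?p"
    by (intro convex_on_bounded_continuous[OF open_ball _] convex_on_subset[OF conv]) auto
  then show "isCont ?p x" using e(1) by (simp add: continuous_on_eq_continuous_at)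
qed

end

subsection \<open>Mixed quasi-variational inequalities\<close>

theorem theorem2p3:
  fixes T :: "'b::banach \<Rightarrow> 'v::banach \<Rightarrow> ('v \<Rightarrow>\<^sub>L real)"
    and \<phi> :: "'v \<Rightarrow> ereal"
    and K :: "'v \<Rightarrow> 'v set"
    and m :: "'v \<Rightarrow>\<^sub>L real"
    and C C0 :: "'v set"
    and A :: "'b set"
    and h :: "real \<Rightarrow> real"
  assumes V_reflexive: "reflexive_space TYPE('v)"
    and C: "C \<noteq> {}" "closed C" "convex C"
    and A: "A \<noteq> {}"
    (* (H_T) *)
    and T_bounded: "\<And>S. bounded S \<Longrightarrow> bounded ((\<lambda>(a, u). T a u) ` S)"
    and T_linear: "\<And>u. linear (\<lambda>a. T a u)"
    and T_monotone: "\<And>a. a \<in> A \<Longrightarrow> monotone_op (T a)"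
    and T_continuous: "\<And>a. a \<in> A \<Longrightarrow> continuous_on UNIV (T a)"
    (* (H_phi) *)
    and phi: "proper_fun \<phi>" "convex_fun \<phi>" "lsc_fun \<phi>"
    and C_dom: "C \<subseteq> interior (dom_fun \<phi>)"
    (* (H_K) *)
    and K_sub: "\<And>u. u \<in> C \<Longrightarrow> K u \<subseteq> C \<and> K u \<noteq> {} \<and> closed (K u) \<and> convex (K u)"
    and K_i: "\<And>xs x y. (\<forall>n. xs n \<in> C) \<Longrightarrow> x \<in> C \<Longrightarrow> weak_conv xs x \<Longrightarrow> y \<in> K x \<Longrightarrow>
               \<exists>ys. (\<forall>n. ys n \<in> C \<and> ys n \<in> K (xs n)) \<and> ys \<longlonglongrightarrow> y"
    and K_ii: "\<And>xs ys x y. (\<forall>n. xs n \<in> C \<and> ys n \<in> C \<and> ys n \<in> K (xs n)) \<Longrightarrow>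
               weak_conv xs x \<Longrightarrow> weak_conv ys y \<Longrightarrow> y \<in> K x"
    (* (H_0) *)
    and C0: "bounded C0" "\<And>u. u \<in> C \<Longrightarrow> K u \<inter> C0 \<noteq> {}"
    and h_lim: "filterlim h at_top at_top"
    and coercive: "\<And>v0 a w. v0 \<in> C0 \<Longrightarrow> a \<in> A \<Longrightarrow> w \<in> C \<Longrightarrow>
        ereal (blinfun_apply (T a w) (w - v0)) + \<phi> w - \<phi> v0 \<ge> ereal (h (norm w) * norm w)"
    and a: "a \<in> A"
  shows "Gamma T \<phi> K m C a \<noteq> {} \<and> bounded (Gamma T \<phi> K m C a)
         \<and> weakly_closed (Gamma T \<phi> K m C a)"
proof -
  define p where "p x = real_of_ereal (\<phi> x)" for x
  have dom: "C \<subseteq> dom_fun \<phi>" using C_dom interior_subset by blast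
  have \<phi>p: "\<phi> x = ereal (p x)" if "x \<in> C" for x
    unfolding p_def using that dom by (intro proper_fun_real[OF phi(1)]) blast
  interpret quasi_variational C "\<lambda>u. T a u - m" p K
  proof
    show "monotone_op (\<lambda>u. T a u - m)"
      using T_monotone[OF a] by (simp add: monotone_op_def)
    show "continuous_on UNIV (\<lambda>u. T a u - m)"
      by (intro continuous_intros T_continuous a)
    show "convex_on C p"
      unfolding p_def by (rule convex_on_real_of_ereal[OF phi(1,2) dom C(3)])
    show "continuous_on C p"
      unfolding p_def by (rule continuous_on_subset[OF continuous_on_interior_dom[OF phi] C_dom])
  qed (use V_reflexive C K_sub K_i K_ii in auto)
  have gap: "ereal (blinfun_apply (T a u) (v - u)) + \<phi> v - \<phi> u \<ge> ereal (blinfun_apply m (v - u))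
      \<longleftrightarrow> stampacchia_gap u v \<ge> 0" if "u \<in> C" "v \<in> C" for u v
    using that by (auto simp: \<phi>p stampacchia_gap_def blinfun.diff_left)
  have \<Gamma>: "Gamma T \<phi> K m C a = {u \<in> C. u \<in> K u \<and> (\<forall>v\<in>K u. stampacchia_gap u v \<ge> 0)}"
    unfolding Gamma_def using gap K_sub by blast
  obtain M where M: "M > 0" "\<And>v. v \<in> C0 \<Longrightarrow> norm v \<le> M"
    using C0(1) unfolding bounded_pos by blast
  \<comment> \<open>\<open>2 * norm m\<close> comes from
    \<open>norm (u - v) \<le> 2 * norm u\<close> for \<open>norm u > M\<close>, and the additional 1
    makes the contradiction strict.\<close>
  obtain N where N: "\<And>t. t \<ge> N \<Longrightarrow> h t \<ge> 2 * norm m + 1"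
    using h_lim unfolding filterlim_at_top eventually_at_top_linorder by meson
  define R where "R = max M N"
  have apriori: "norm u \<le> R" if u: "u \<in> C" and v: "v \<in> K u \<inter> C0" and ge: "stampacchia_gap u v \<ge> 0" for u v
  proof (rule ccontr)
    assume "\<not> norm u \<le> R"
    then have uMN: "norm u > M" "norm u > N" by (auto simp: R_def)
    have vC: "v \<in> C" using K_sub[OF u] v by blast
    have "h (norm u) * norm u \<le> blinfun_apply (T a u) (u - v) + p u - p v"
      using coercive[OF _ a u, of v] v by (simp add: \<phi>p[OF u] \<phi>p[OF vC])
    also have "\<dots> = blinfun_apply m (u - v) - stampacchia_gap u v"
      by (simp add: stampacchia_gap_def blinfun.diff_left blinfun.diff_right)
    also have "\<dots> \<le> norm m * norm (u - v)" using norm_blinfun[of m "u - v"] ge by simp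
    also have "\<dots> \<le> norm m * (norm u + norm u)"
      using norm_triangle_ineq4[of u v] M(2)[of v] v uMN by (intro mult_left_mono) auto
    finally have "h (norm u) * norm u \<le> (2 * norm m) * norm u" by simp
    then have "h (norm u) \<le> 2 * norm m"
      by (rule mult_right_le_imp_le) (use uMN(1) M(1) in linarith)
    then show False using N[of "norm u"] uMN by simp
  qed
  have bound: "norm u \<le> R" if "u \<in> Gamma T \<phi> K m C a" for u
  proof -
    have uC: "u \<in> C" using that by (simp add: \<Gamma>)
    then obtain v where v: "v \<in> K u \<inter> C0" using C0(2) by blast
    then show ?thesis using that by (intro apriori[OF uC v]) (simp add: \<Gamma>)
  qed
  have bdd: "bounded (Gamma T \<phi> K m C a)" using bound by (auto simp: bounded_iff)
  have "Gamma T \<phi> K m C a \<noteq> {}"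
  proof -
    have "C0 \<subseteq> cball 0 R" using M(2) by (force simp: R_def)
    then obtain u where "u \<in> C" "u \<in> K u" "\<And>v. v \<in> K u \<Longrightarrow> stampacchia_gap u v \<ge> 0"
      by (rule solution_exists) (use C0(2) apriori in blast)+
    then show ?thesis unfolding \<Gamma> by blast
  qed
  moreover have "weakly_closed (Gamma T \<phi> K m C a)"
  proof (rule weakly_closed_if_sequentially[OF V_reflexive bdd])
    fix xs x assume xs: "\<And>n. xs n \<in> Gamma T \<phi> K m C a" "weak_conv xs x"
    have xsC: "xs n \<in> C" and xsK: "xs n \<in> K (xs n)" for n using xs(1)[of n] by (auto simp: \<Gamma>)
    have xC: "x \<in> C" by (rule weak_limit_in_C[OF xsC xs(2)])
    have xK: "x \<in> K x" by (rule K_ii[OF _ xs(2) xs(2)]) (simp add: xsC xsK)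
    \<comment> \<open>Solutions have nonnegative Minty gaps, which survive the weak limit;
      \<open>minty\<close> then returns to the Stampacchia gap at \<open>x\<close>. Nothing is
      truncated here, so the open set is the whole space.\<close>
    have minty_x: "minty_gap x y \<ge> 0" if "y \<in> K x" for y
    proof (rule minty_weakly_closed[OF xsC xs(2) bound[OF xs(1)] open_UNIV _ that UNIV_I])
      fix n z assume "z \<in> K (xs n)"
      then have "stampacchia_gap (xs n) z \<ge> 0" using xs(1)[of n] by (simp add: \<Gamma>)
      then show "minty_gap (xs n) z \<ge> 0" using stampacchia_le_minty order_trans by blast
    qed
    have "stampacchia_gap x v \<ge> 0" if v: "v \<in> K x" for v
    proof (rule minty[OF xC])
      show "v \<in> C" using K_sub[OF xC] v by blast
      fix t :: real assume t: "0 < t" "t \<le> 1"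
      have "(1 - t) *\<^sub>R x + t *\<^sub>R v \<in> K x"
        using K_sub[OF xC] xK v t by (intro convexD) auto
      then show "minty_gap x (x + t *\<^sub>R (v - x)) \<ge> 0"
        by (intro minty_x) (simp add: algebra_simps)
    qed
    then show "x \<in> Gamma T \<phi> K m C a" using xC xK by (simp add: \<Gamma>)
  qed
  ultimately show ?thesis using bdd by blast
qed

end
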